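(* Let $g\ge 2$ and $m\ge 2$ be integers and let $\mathsf{D}_{2m}$ be the dihedral group of order $2m$. The number $N_g^{\circ}(\mathsf{D}_{2m})$ of admissible epimorphisms $\varphi\colon\mathsf{B}_2(\Sigma_g)\to\mathsf{D}_{2m}$, up to automorphisms of $\mathsf{D}_{2m}$, is $$N_g^{\circ}(\mathsf{D}_{2m})=\frac{1}{|\operatorname{Aut}(\mathsf{D}_{2m})|}N_g(\mathsf{D}_{2m})=\begin{cases}J_{2g}(m)/\phi(m)&\text{if } m\notin\{2,4\},\\ J_{2g}(4)&\text{if } m=4,\\ 2^{2g-1}J_{2g}(2)&\text{if } m=2,\end{cases}$$ where $N_g(\mathsf{D}_{2m})$ is the total number of admissible epimorphisms $\mathsf{B}_2(\Sigma_g)\to\mathsf{D}_{2m}$ and $\phi$ is Euler's totient function.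
   Context: Commutators are $[x,y]=xyx^{-1}y^{-1}$. Let $\Sigma_g$ be a compact Riemann surface of genus $g$. The full braid group on two strings $\mathsf{B}_2(\Sigma_g)\simeq\pi_1(\operatorname{Sym}^2\Sigma_g-\delta)$ (with $\delta$ the diagonal) is the group generated by $a_1,b_1,\dots,a_g,b_g,\sigma$ subject to the relations: $[a_i,\sigma^{-1}a_i\sigma^{-1}]=1$ and $[b_i,\sigma^{-1}b_i\sigma^{-1}]=1$ for $1\le i\le g$; $[a_i,\sigma^{-1}a_j\sigma]=[a_i,\sigma^{-1}b_j\sigma]=[b_i,\sigma^{-1}a_j\sigma]=[b_i,\sigma^{-1}b_j\sigma]=1$ for $j<i$; $[a_i,\sigma^{-1}b_i\sigma^{-1}]=\sigma^2$ for $1\le i\le g$; and $[a_1,b_1^{-1}]\cdots[a_g,b_g^{-1}]=\sigma^2$. For a finite group $G$, a group epimorphism $\varphi\colon\mathsf{B}_2(\Sigma_g)\to G$ is called admissible if $\varphi(\sigma)$ has order $n\ge 2$ (i.e. $\varphi(\sigma)\neq 1$). $N_g^{\circ}(G)$ is the number of orbits of $\operatorname{Aut}(G)$ acting by post-composition on the set of admissible epimorphisms $\mathsf{B}_2(\Sigma_g)\to G$. $\mathsf{D}_{2m}=\langle x,y\mid x^2=1,\ y^m=1,\ xyx^{-1}=y^{-1}\rangle$; for $m=2$ this is $\mathsf{D}_4\simeq\mathsf{C}_2\times\mathsf{C}_2$, where $\mathsf{C}_m$ denotes the cyclic group of order $m$. $J_k(m)$ is the Jordan totient: the number of ordered $k$-tuples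 of elements of $\mathsf{C}_m$ generating $\mathsf{C}_m$; equivalently $J_k(m)=m^k\prod_{p\mid m}(1-p^{-k})$, the product being over the distinct primes $p$ dividing $m$. *)

theory Defs
  imports "HOL-Algebra.Algebra" "HOL-Number_Theory.Number_Theory"
begin

section \<open>Groups given by generators and relations\<close>

text \<open>
  A letter \<open>(x, True)\<close> stands for the generator \<open>x\<close> and \<open>(x, False)\<close> for its formal inverse.
  A relation \<open>u = v\<close> is encoded as the pair \<open>(u, v)\<close> of words.
\<close>

type_synonym 'a word = "('a \<times> bool) list"

definition words :: "'a set \<Rightarrow> 'a word set" where
  "words S = lists (S \<times> UNIV)"

definition letter :: "'a \<Rightarrow> 'a word" where
  "letter x = [(x, True)]"

definition winv :: "'a word \<Rightarrow> 'a word" where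
  "winv w = rev (map (\<lambda>(x, b). (x, \<not> b)) w)"

definition wcomm :: "'a word \<Rightarrow> 'a word \<Rightarrow> 'a word" where
  "wcomm u v = u @ v @ winv u @ winv v"

text \<open>
  The smallest congruence on the words over \<open>S\<close> that contains free cancellation and \<open>R\<close>; the
  guard in \<open>relation\<close> only matters for relations involving letters outside \<open>S\<close>.
\<close>

inductive pres_eq :: "'a set \<Rightarrow> ('a word \<times> 'a word) set \<Rightarrow> 'a word \<Rightarrow> 'a word \<Rightarrow> bool"
  for S :: "'a set" and R :: "('a word \<times> 'a word) set" where
  refl: "u \<in> words S \<Longrightarrow> pres_eq S R u u"
| sym: "pres_eq S R u v \<Longrightarrow> pres_eq S R v u"
| trans: "pres_eq S R u v \<Longrightarrow> pres_eq S R v w \<Longrightarrow> pres_eq S R u w"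
| append: "pres_eq S R u u' \<Longrightarrow> pres_eq S R v v' \<Longrightarrow> pres_eq S R (u @ v) (u' @ v')"
| cancel: "x \<in> S \<Longrightarrow> pres_eq S R [(x, b), (x, \<not> b)] []"
| relation: "(u, v) \<in> R \<Longrightarrow> u \<in> words S \<Longrightarrow> v \<in> words S \<Longrightarrow> pres_eq S R u v"

definition word_class :: "'a set \<Rightarrow> ('a word \<times> 'a word) set \<Rightarrow> 'a word \<Rightarrow> 'a word set" where
  "word_class S R u = {v. pres_eq S R u v}"

definition presented_group :: "'a set \<Rightarrow> ('a word \<times> 'a word) set \<Rightarrow> 'a word set monoid" where
  "presented_group S R =
     \<lparr> carrier = word_class S R ` words S,
       monoid.mult = (\<lambda>P Q. \<Union>u\<in>P. \<Union>v\<in>Q. word_class S R (u @ v)),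
       monoid.one = word_class S R [] \<rparr>"

lemma words_simps [simp]:
  "[] \<in> words S"
  "u @ v \<in> words S \<longleftrightarrow> u \<in> words S \<and> v \<in> words S"
  "(x, b) # u \<in> words S \<longleftrightarrow> x \<in> S \<and> u \<in> words S"
  "letter x \<in> words S \<longleftrightarrow> x \<in> S"
  by (auto simp: words_def letter_def)

lemma winv_in_words [simp]: "winv u \<in> words S \<longleftrightarrow> u \<in> words S"
  by (force simp: winv_def words_def in_lists_conv_set)

lemma wcomm_in_words [simp]: "wcomm u v \<in> words S \<longleftrightarrow> u \<in> words S \<and> v \<in> words S"
  by (auto simp: wcomm_def)

lemma pres_eq_in_words: "pres_eq S R u v \<Longrightarrow> u \<in> words S \<and> v \<in> words S"
  by (induction rule: pres_eq.induct) auto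

lemma word_class_eq_iff:
  assumes "u \<in> words S"
  shows "word_class S R u = word_class S R v \<longleftrightarrow> pres_eq S R u v"
  unfolding word_class_def using assms
  by (auto intro: pres_eq.refl pres_eq.sym pres_eq.trans)

lemma presented_group_mult:
  assumes "u \<in> words S" "v \<in> words S"
  shows "word_class S R u \<otimes>\<^bsub>presented_group S R\<^esub> word_class S R v = word_class S R (u @ v)"
proof -
  have eq: "word_class S R (u' @ v') = word_class S R (u @ v)"
    if "u' \<in> word_class S R u" "v' \<in> word_class S R v" for u' v'
  proof -
    have "pres_eq S R (u @ v) (u' @ v')"
      using that by (simp add: word_class_def pres_eq.append)
    then show ?thesis
      using assms word_class_eq_iff[of "u @ v" S R "u' @ v'"] by simp
  qed
  have "u \<in> word_class S R u" "v \<in> word_class S R v"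
    using assms by (auto simp: word_class_def intro: pres_eq.refl)
  then have "(\<Union>u'\<in>word_class S R u. \<Union>v'\<in>word_class S R v. word_class S R (u' @ v'))
      = word_class S R (u @ v)"
    using eq by blast
  then show ?thesis
    by (simp add: presented_group_def)
qed

lemma pres_eq_winv:
  "u \<in> words S \<Longrightarrow> pres_eq S R (winv u @ u) []"
proof (induction u)
  case Nil
  then show ?case by (simp add: winv_def pres_eq.refl)
next
  case (Cons p u)
  obtain x b where p: "p = (x, b)" by fastforce
  with Cons.prems have x: "x \<in> S" and u: "u \<in> words S" by auto
  have "pres_eq S R ([(x, \<not> b), (x, \<not> \<not> b)] @ u) ([] @ u)"
    using x u by (intro pres_eq.append pres_eq.cancel pres_eq.refl) simp_all
  then have "pres_eq S R (winv u @ ([(x, \<not> b), (x, \<not> \<not> b)] @ u)) (winv u @ ([] @ u))"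
    by (rule pres_eq.append[rotated]) (use u in \<open>simp add: pres_eq.refl\<close>)
  then have "pres_eq S R (winv u @ ([(x, \<not> b), (x, \<not> \<not> b)] @ u)) []"
    using Cons.IH[OF u] by (simp only: append_Nil) (rule pres_eq.trans)
  then show ?case
    by (simp add: p winv_def)
qed

theorem group_presented_group: "group (presented_group S R)"
proof (rule groupI)
  show "\<one>\<^bsub>presented_group S R\<^esub> \<in> carrier (presented_group S R)"
    by (auto simp: presented_group_def)
next
  fix P Q assume "P \<in> carrier (presented_group S R)" "Q \<in> carrier (presented_group S R)"
  then show "P \<otimes>\<^bsub>presented_group S R\<^esub> Q \<in> carrier (presented_group S R)"
    using presented_group_mult[of _ S _ R] by (force simp: presented_group_def)
next
  fix P Q T assume "P \<in> carrier (presented_group S R)" "Q \<in> carrier (presented_group S R)"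
    "T \<in> carrier (presented_group S R)"
  then obtain u v w where "P = word_class S R u" "Q = word_class S R v" "T = word_class S R w"
    "u \<in> words S" "v \<in> words S" "w \<in> words S"
    by (auto simp: presented_group_def)
  then show "P \<otimes>\<^bsub>presented_group S R\<^esub> Q \<otimes>\<^bsub>presented_group S R\<^esub> T =
      P \<otimes>\<^bsub>presented_group S R\<^esub> (Q \<otimes>\<^bsub>presented_group S R\<^esub> T)"
    by (simp add: presented_group_mult)
next
  fix P assume "P \<in> carrier (presented_group S R)"
  then obtain u where u: "P = word_class S R u" "u \<in> words S"
    by (auto simp: presented_group_def)
  have one: "\<one>\<^bsub>presented_group S R\<^esub> = word_class S R []"
    by (simp add: presented_group_def)
  show "\<one>\<^bsub>presented_group S R\<^esub> \<otimes>\<^bsub>presented_group S R\<^esub> P = P"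
    using u by (simp add: one presented_group_mult)
  have "word_class S R (winv u) \<otimes>\<^bsub>presented_group S R\<^esub> P = \<one>\<^bsub>presented_group S R\<^esub>"
    using u by (simp add: one presented_group_mult word_class_eq_iff pres_eq_winv)
  moreover have "word_class S R (winv u) \<in> carrier (presented_group S R)"
    using u by (simp add: presented_group_def)
  ultimately show "\<exists>Q\<in>carrier (presented_group S R).
      Q \<otimes>\<^bsub>presented_group S R\<^esub> P = \<one>\<^bsub>presented_group S R\<^esub>" by blast
qed


section \<open>The two-string braid group of a surface of genus \<open>g\<close>\<close>

datatype braid_gen = Gen_a nat | Gen_b nat | Gen_sigma

definition braid_gens :: "nat \<Rightarrow> braid_gen set" where
  "braid_gens g = Gen_a ` {1..g} \<union> Gen_b ` {1..g} \<union> {Gen_sigma}"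

definition braid_rels :: "nat \<Rightarrow> (braid_gen word \<times> braid_gen word) set" where
  "braid_rels g =
    (let a = (\<lambda>i. letter (Gen_a i)); b = (\<lambda>i. letter (Gen_b i)); s = letter Gen_sigma; s' = winv s in
       {(wcomm (a i) (s' @ a i @ s'), []) | i. i \<in> {1..g}}
     \<union> {(wcomm (b i) (s' @ b i @ s'), []) | i. i \<in> {1..g}}
     \<union> {(wcomm (a i) (s' @ a j @ s), []) | i j. i \<in> {1..g} \<and> j \<in> {1..g} \<and> j < i}
     \<union> {(wcomm (a i) (s' @ b j @ s), []) | i j. i \<in> {1..g} \<and> j \<in> {1..g} \<and> j < i}
     \<union> {(wcomm (b i) (s' @ a j @ s), []) | i j. i \<in> {1..g} \<and> j \<in> {1..g} \<and> j < i}
     \<union> {(wcomm (b i) (s' @ b j @ s), []) | i j. i \<in> {1..g} \<and> j \<in> {1..g} \<and> j < i}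
     \<union> {(wcomm (a i) (s' @ b i @ s'), s @ s) | i. i \<in> {1..g}}
     \<union> {(concat (map (\<lambda>i. wcomm (a i) (winv (b i))) [1..<Suc g]), s @ s)})"

lemma braid_rels_words: "braid_rels g \<subseteq> words (braid_gens g) \<times> words (braid_gens g)"
proof -
  have "concat (map f xs) \<in> words S" if "\<forall>i\<in>set xs. f i \<in> words S"
    for f :: "nat \<Rightarrow> braid_gen word" and xs S
    using that by (induction xs) auto
  then show ?thesis
    by (auto simp: braid_rels_def braid_gens_def Let_def)
qed

definition braid_group :: "nat \<Rightarrow> braid_gen word set monoid" where
  "braid_group g = presented_group (braid_gens g) (braid_rels g)"

definition braid_sigma :: "nat \<Rightarrow> braid_gen word set" where
  "braid_sigma g = word_class (braid_gens g) (braid_rels g) (letter Gen_sigma)"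

lemma group_braid_group: "group (braid_group g)"
  by (simp add: braid_group_def group_presented_group)

lemma braid_sigma_closed: "braid_sigma g \<in> carrier (braid_group g)"
  by (auto simp: braid_sigma_def braid_group_def presented_group_def braid_gens_def)


section \<open>Admissible epimorphisms up to automorphisms\<close>

text \<open>Homomorphisms are made extensional so that each is counted exactly once.\<close>

definition admissible_epis ::
    "nat \<Rightarrow> ('b, 'c) monoid_scheme \<Rightarrow> (braid_gen word set \<Rightarrow> 'b) set" where
  "admissible_epis g G =
     {\<phi> \<in> epi (braid_group g) G \<inter> extensional (carrier (braid_group g)).
        2 \<le> group.ord G (\<phi> (braid_sigma g))}"

lemma ord_ge_2_iff:
  assumes "group G" "finite (carrier G)" "x \<in> carrier G"
  shows "2 \<le> group.ord G x \<longleftrightarrow> x \<noteq> \<one>\<^bsub>G\<^esub>"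
  using group.ord_eq_1[OF assms(1,3)] group.ord_ge_1[OF assms] by linarith

definition aut_postcomp ::
    "nat \<Rightarrow> ('b, 'c) monoid_scheme \<Rightarrow> ('b \<Rightarrow> 'b)
       \<Rightarrow> (braid_gen word set \<Rightarrow> 'b) \<Rightarrow> (braid_gen word set \<Rightarrow> 'b)" where
  "aut_postcomp g G \<alpha> = (\<lambda>\<phi> \<in> admissible_epis g G. compose (carrier (braid_group g)) \<alpha> \<phi>)"

definition num_admissible_epis :: "nat \<Rightarrow> ('b, 'c) monoid_scheme \<Rightarrow> nat" where
  "num_admissible_epis g G = card (admissible_epis g G)"

definition num_admissible_epis_mod_aut :: "nat \<Rightarrow> ('b, 'c) monoid_scheme \<Rightarrow> nat" where
  "num_admissible_epis_mod_aut g G =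
     card (orbits (AutoGroup G) (admissible_epis g G) (aut_postcomp g G))"

lemma compose_admissible:
  assumes G: "group G" and \<alpha>: "\<alpha> \<in> auto G" and \<phi>: "\<phi> \<in> admissible_epis g G"
  shows "compose (carrier (braid_group g)) \<alpha> \<phi> \<in> admissible_epis g G"
proof -
  interpret G: group G by fact
  have a: "\<alpha> \<in> hom G G" "bij_betw \<alpha> (carrier G) (carrier G)"
    using \<alpha> by (auto simp: auto_def Bij_def)
  have p: "\<phi> \<in> hom (braid_group g) G" "\<phi> ` carrier (braid_group g) = carrier G"
    "2 \<le> G.ord (\<phi> (braid_sigma g))"
    using \<phi> by (auto simp: admissible_epis_def epi_def)
  interpret B: group "braid_group g" by (rule group_braid_group)
  have "compose (carrier (braid_group g)) \<alpha> \<phi> \<in> hom (braid_group g) G"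
    using a p by (auto simp: hom_def compose_def Pi_iff)
  moreover have "compose (carrier (braid_group g)) \<alpha> \<phi> ` carrier (braid_group g) = carrier G"
    using a(2) p(2) by (simp add: surj_compose bij_betw_def)
  moreover have "G.ord (\<alpha> x) = G.ord x" if "x \<in> carrier G" for x
  proof -
    interpret h: group_hom G G \<alpha> using a by unfold_locales
    have "\<alpha> x [^]\<^bsub>G\<^esub> n = \<one>\<^bsub>G\<^esub> \<longleftrightarrow> x [^]\<^bsub>G\<^esub> n = \<one>\<^bsub>G\<^esub>" for n :: nat
    proof -
      have "\<alpha> x [^]\<^bsub>G\<^esub> n = \<alpha> (x [^]\<^bsub>G\<^esub> n)" "\<one>\<^bsub>G\<^esub> = \<alpha> \<one>\<^bsub>G\<^esub>"
        using that by (simp_all add: h.hom_nat_pow)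
      moreover have "inj_on \<alpha> (carrier G)"
        using a(2) by (simp add: bij_betw_def)
      ultimately show ?thesis
        using that inj_on_eq_iff[of \<alpha> "carrier G" "x [^]\<^bsub>G\<^esub> n" "\<one>\<^bsub>G\<^esub>"] by simp
    qed
    then show ?thesis unfolding G.ord_def by simp
  qed
  ultimately show ?thesis
    using p braid_sigma_closed[of g]
    by (auto simp: admissible_epis_def epi_def compose_eq hom_in_carrier)
qed

theorem group_action_aut_postcomp:
  assumes "group G"
  shows "group_action (AutoGroup G) (admissible_epis g G) (aut_postcomp g G)"
proof -
  let ?E = "admissible_epis g G" and ?C = "carrier (braid_group g)"
  have A: "group (AutoGroup G)" using assms by (rule group.AutoGroup)
  have car: "carrier (AutoGroup G) = auto G" by (simp add: AutoGroup_def)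
  have \<phi>C: "\<phi> \<in> ?C \<rightarrow> carrier G" "\<phi> \<in> extensional ?C" if "\<phi> \<in> ?E" for \<phi>
    using that by (auto simp: admissible_epis_def epi_def hom_def)
  have mult: "\<alpha> \<otimes>\<^bsub>AutoGroup G\<^esub> \<beta> = compose (carrier G) \<alpha> \<beta>"
    if "\<alpha> \<in> auto G" "\<beta> \<in> auto G" for \<alpha> \<beta>
    using that by (simp add: AutoGroup_def BijGroup_def auto_def)
  have comp: "compose ?C (compose (carrier G) \<alpha> \<beta>) \<phi> = compose ?C \<alpha> (compose ?C \<beta> \<phi>)"
    if "\<phi> \<in> ?E" for \<alpha> \<beta> \<phi>
    using \<phi>C[OF that] by (auto simp: compose_def fun_eq_iff)
  have mem: "aut_postcomp g G \<alpha> \<in> Bij ?E" if \<alpha>: "\<alpha> \<in> auto G" for \<alpha>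
  proof -
    define \<beta> where "\<beta> = inv\<^bsub>AutoGroup G\<^esub> \<alpha>"
    have \<beta>: "\<beta> \<in> auto G"
      using group.inv_closed[OF A, of \<alpha>] \<alpha> by (simp add: \<beta>_def car)
    have one: "\<one>\<^bsub>AutoGroup G\<^esub> = (\<lambda>x\<in>carrier G. x)"
      by (simp add: AutoGroup_def BijGroup_def)
    have 1: "compose (carrier G) \<alpha> \<beta> = (\<lambda>x\<in>carrier G. x)"
      "compose (carrier G) \<beta> \<alpha> = (\<lambda>x\<in>carrier G. x)"
      using group.r_inv[OF A, of \<alpha>] group.l_inv[OF A, of \<alpha>] \<alpha> \<beta>
      by (simp_all add: car \<beta>_def[symmetric] mult one)
    have id: "compose ?C (\<lambda>x\<in>carrier G. x) \<phi> = \<phi>" if "\<phi> \<in> ?E" for \<phi>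
      using \<phi>C[OF that] by (simp add: Id_compose)
    have "bij_betw (compose ?C \<alpha>) ?E ?E"
    proof (rule bij_betwI)
      show "compose ?C \<alpha> \<in> ?E \<rightarrow> ?E" "compose ?C \<beta> \<in> ?E \<rightarrow> ?E"
        using compose_admissible[OF assms] \<alpha> \<beta> by auto
    next
      fix \<phi> assume \<phi>: "\<phi> \<in> ?E"
      show "compose ?C \<beta> (compose ?C \<alpha> \<phi>) = \<phi>"
        using comp[OF \<phi>, of \<beta> \<alpha>] id[OF \<phi>] 1(2) by simp
      show "compose ?C \<alpha> (compose ?C \<beta> \<phi>) = \<phi>"
        using comp[OF \<phi>, of \<alpha> \<beta>] id[OF \<phi>] 1(1) by simp
    qed
    then show ?thesis
      by (auto simp: Bij_def aut_postcomp_def cong: bij_betw_cong)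
  qed
  show ?thesis
  proof (intro group_action.intro group_hom.intro A group_BijGroup group_hom_axioms.intro homI)
    fix \<alpha> assume "\<alpha> \<in> carrier (AutoGroup G)"
    then show "aut_postcomp g G \<alpha> \<in> carrier (BijGroup ?E)"
      by (simp add: car mem BijGroup_def)
  next
    fix \<alpha> \<beta> assume *: "\<alpha> \<in> carrier (AutoGroup G)" "\<beta> \<in> carrier (AutoGroup G)"
    then have "aut_postcomp g G (compose (carrier G) \<alpha> \<beta>) =
        compose ?E (aut_postcomp g G \<alpha>) (aut_postcomp g G \<beta>)"
      by (intro ext) (auto simp: aut_postcomp_def compose_def[of ?E] comp car
          compose_admissible[OF assms])
    then show "aut_postcomp g G (\<alpha> \<otimes>\<^bsub>AutoGroup G\<^esub> \<beta>) =
        aut_postcomp g G \<alpha> \<otimes>\<^bsub>BijGroup ?E\<^esub> aut_postcomp g G \<beta>"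
      using * by (simp add: car mult mem BijGroup_def)
  qed
qed


section \<open>Dihedral groups\<close>

datatype dihedral_gen = Gen_x | Gen_y

definition dihedral_rels :: "nat \<Rightarrow> (dihedral_gen word \<times> dihedral_gen word) set" where
  "dihedral_rels m =
     {(letter Gen_x @ letter Gen_x, []),
      (concat (replicate m (letter Gen_y)), []),
      (letter Gen_x @ letter Gen_y @ winv (letter Gen_x), winv (letter Gen_y))}"

text \<open>The dihedral group of order \<open>2 * m\<close>; the argument \<open>m\<close> is the order of the rotations.\<close>

definition dihedral_group :: "nat \<Rightarrow> dihedral_gen word set monoid" where
  "dihedral_group m = presented_group {Gen_x, Gen_y} (dihedral_rels m)"

lemma group_dihedral_group: "group (dihedral_group m)"
  by (simp add: dihedral_group_def group_presented_group)


section \<open>The Jordan totient\<close>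

definition jordan_totient :: "nat \<Rightarrow> nat \<Rightarrow> nat" where
  "jordan_totient k m =
     card {t \<in> {..<k} \<rightarrow>\<^sub>E carrier (integer_mod_group m).
             generate (integer_mod_group m) (t ` {..<k}) = carrier (integer_mod_group m)}"

end

theory Submission
  imports Defs
begin

text \<open>
  A homomorphism out of a presented group is a tuple of values on the generators that satisfies the
  relations, and it is onto exactly when the tuple generates the target
  (\<open>bij_betw_epis_tuples\<close>).  Both the admissible epimorphisms and, since a surjective endomorphism
  of a finite group is bijective, the automorphisms of the dihedral group are therefore generating
  tuples in a concrete model \<open>dih m\<close> of that group.  An automorphism that fixes an epimorphism is the
  identity, so \<open>Aut\<close> acts freely and the number of orbits is the quotient of the two counts
  (\<open>card_orbits_admissible\<close>).

  Let \<open>s\<close> be the image of \<open>\<sigma>\<close> and suppose first that \<open>m \<ge> 3\<close>.  If \<open>s\<close> were a non-trivial rotation,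
  the relations between two different handles would force \<open>s\<^sup>2 = 1\<close>; then \<open>s\<close> is central, the
  relations say that all images commute, and the dihedral group would be abelian.  So \<open>s\<close> is one of
  the \<open>m\<close> reflections (\<open>sigma_reflection\<close>; it is here that two handles are required).

  Write the other images as \<open>s\<^sup>e y\<^sup>t\<close>, one pair \<open>(e, t)\<close> for each of the \<open>2g\<close> handle generators.  For
  any subgroup \<open>A\<close> of rotations, \<open>A \<union> s A\<close> is a subgroup.  Hence the tuple generates the dihedral
  group exactly when the exponents \<open>t\<close> generate \<open>C\<^sub>m\<close>, whatever the bits \<open>e\<close> are
  (\<open>generate_dih_iff\<close>); this is where the Jordan totient \<open>J\<^bsub>2g\<^esub>(m)\<close> comes from.  Conjugation by \<open>s\<close>
  negates \<open>t\<close>, and the relations become pairwise congruences: with both bits off they are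
  empty, while \<open>s y\<^sup>t\<close> compared with itself gives \<open>4t = 0\<close>, and compared with the others spreads
  this to all exponents.  As the exponents generate \<open>C\<^sub>m\<close>, either all bits are off or \<open>m = 4\<close>, and in
  the latter case the congruences say that \<open>e\<close> is the parity of \<open>t\<close>
  (\<open>handle_relations_generating_iff\<close>).  There are thus \<open>m J\<^bsub>2g\<^esub>(m)\<close> admissible epimorphisms, and
  twice as many for \<open>m = 4\<close>.  The same coordinates applied to pairs \<open>(x, y)\<close> give
  \<open>|Aut| = m \<phi>(m)\<close>.

  For \<open>m = 2\<close> every relation holds because the group is abelian of exponent 2.  The bits are then
  arbitrary, which contributes \<open>2\<^bsup>2g\<^esup>\<close>, and there are three possible values of \<open>s\<close>, permuted by
  automorphisms (\<open>card_tuples_klein\<close>), against \<open>|Aut| = 6\<close>.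
\<close>


section \<open>Epimorphisms out of a presented group\<close>

definition word_val :: "('b, 'c) monoid_scheme \<Rightarrow> ('a \<Rightarrow> 'b) \<Rightarrow> 'a word \<Rightarrow> 'b" where
  "word_val G c w = foldr (\<lambda>(x, b) h. (if b then c x else inv\<^bsub>G\<^esub> c x) \<otimes>\<^bsub>G\<^esub> h) w \<one>\<^bsub>G\<^esub>"

text \<open>
  The guard on words mirrors the definition of a presented group, which imposes only the relations
  between words over \<open>S\<close>.
\<close>

definition satisfies :: "('b, 'c) monoid_scheme \<Rightarrow> 'a set \<Rightarrow> ('a word \<times> 'a word) set \<Rightarrow> ('a \<Rightarrow> 'b) \<Rightarrow> bool" where
  "satisfies G S R c \<longleftrightarrow>
     (\<forall>(u, v)\<in>R. u \<in> words S \<longrightarrow> v \<in> words S \<longrightarrow> word_val G c u = word_val G c v)"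

definition generating_tuples :: "('b, 'c) monoid_scheme \<Rightarrow> 'a set \<Rightarrow> ('a \<Rightarrow> 'b) set" where
  "generating_tuples G S = {c \<in> S \<rightarrow>\<^sub>E carrier G. generate G (c ` S) = carrier G}"

context group
begin

lemma word_val_Nil [simp]: "word_val G c [] = \<one>"
  by (simp add: word_val_def)

lemma word_val_Cons:
  "word_val G c ((x, b) # w) = (if b then c x else inv c x) \<otimes> word_val G c w"
  by (simp add: word_val_def)

lemma word_val_closed: "c \<in> S \<rightarrow> carrier G \<Longrightarrow> w \<in> words S \<Longrightarrow> word_val G c w \<in> carrier G"
  by (induction w) (auto simp: word_val_Cons Pi_iff)

lemma word_val_append:
  assumes "c \<in> S \<rightarrow> carrier G" "u \<in> words S" "v \<in> words S"
  shows "word_val G c (u @ v) = word_val G c u \<otimes> word_val G c v"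
  using assms(2)
proof (induction u)
  case Nil
  then show ?case using assms by (simp add: word_val_closed)
next
  case (Cons p u)
  obtain x b where p: "p = (x, b)" by fastforce
  have "c x \<in> carrier G" "word_val G c u \<in> carrier G" "word_val G c v \<in> carrier G"
    using assms Cons.prems word_val_closed[of c S] by (auto simp: p)
  then show ?case using Cons by (simp add: p word_val_Cons m_assoc)
qed

lemma word_val_letter: "c x \<in> carrier G \<Longrightarrow> word_val G c (letter x) = c x"
  by (simp add: letter_def word_val_Cons)

lemma word_val_winv:
  assumes "c \<in> S \<rightarrow> carrier G" "u \<in> words S"
  shows "word_val G c (winv u) = inv (word_val G c u)"
  using assms(2)
proof (induction u)
  case Nil
  then show ?case by (simp add: winv_def)
next
  case (Cons p u)
  obtain x b where p: "p = (x, b)" by fastforce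
  have c: "c x \<in> carrier G" "word_val G c u \<in> carrier G" "x \<in> S" "u \<in> words S"
    using assms Cons.prems word_val_closed[of c S] by (auto simp: p)
  have "winv (p # u) = winv u @ [(x, \<not> b)]" by (simp add: p winv_def)
  then show ?case
    using Cons.IH c word_val_append[OF assms(1), of "winv u" "[(x, \<not> b)]"]
    by (simp add: p word_val_Cons inv_mult_group)
qed

lemma word_val_pres_eq:
  assumes c: "c \<in> S \<rightarrow> carrier G" and R: "satisfies G S R c" and "pres_eq S R u v"
  shows "word_val G c u = word_val G c v"
  using assms(3)
proof (induction rule: pres_eq.induct)
  case (append u u' v v')
  then show ?case
    using pres_eq_in_words[of S R u u'] pres_eq_in_words[of S R v v'] by (simp add: word_val_append[OF c])
next
  case (cancel x b)
  then have "c x \<in> carrier G" using c by auto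
  then show ?case by (simp add: word_val_Cons)
next
  case (relation u v)
  then show ?case using R by (auto simp: satisfies_def)
qed auto

end

lemma carrier_presented: "P \<in> carrier (presented_group S R) \<longleftrightarrow> (\<exists>u\<in>words S. P = word_class S R u)"
  by (auto simp: presented_group_def)

lemma one_presented: "\<one>\<^bsub>presented_group S R\<^esub> = word_class S R []"
  by (simp add: presented_group_def)

text \<open>
  The homomorphism with prescribed values on the generators.  A class is evaluated on a chosen
  representative; \<open>word_val_pres_eq\<close> makes the choice irrelevant.
\<close>

definition tuple_hom ::
    "('b, 'c) monoid_scheme \<Rightarrow> 'a set \<Rightarrow> ('a word \<times> 'a word) set \<Rightarrow> ('a \<Rightarrow> 'b) \<Rightarrow> 'a word set \<Rightarrow> 'b" where
  "tuple_hom G S R c =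
     (\<lambda>P \<in> carrier (presented_group S R). word_val G c (SOME u. u \<in> words S \<and> P = word_class S R u))"

context group
begin

lemma tuple_hom_class:
  assumes c: "c \<in> S \<rightarrow> carrier G" and R: "satisfies G S R c" and u: "u \<in> words S"
  shows "tuple_hom G S R c (word_class S R u) = word_val G c u"
proof -
  let ?P = "\<lambda>v. v \<in> words S \<and> word_class S R u = word_class S R v"
  have "?P (SOME v. ?P v)" by (rule someI[of _ u]) (use u in simp)
  then have "pres_eq S R u (SOME v. ?P v)" using word_class_eq_iff[OF u] by blast
  then show ?thesis
    using word_val_pres_eq[OF c R] u by (auto simp: tuple_hom_def carrier_presented)
qed

lemma tuple_hom_hom:
  assumes c: "c \<in> S \<rightarrow> carrier G" and R: "satisfies G S R c"
  shows "tuple_hom G S R c \<in> hom (presented_group S R) G"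
proof (rule homI)
  fix P assume "P \<in> carrier (presented_group S R)"
  then show "tuple_hom G S R c P \<in> carrier G"
    using tuple_hom_class[OF assms] word_val_closed[OF c] by (auto simp: carrier_presented)
next
  fix P Q assume "P \<in> carrier (presented_group S R)" "Q \<in> carrier (presented_group S R)"
  then show "tuple_hom G S R c (P \<otimes>\<^bsub>presented_group S R\<^esub> Q) = tuple_hom G S R c P \<otimes> tuple_hom G S R c Q"
    using tuple_hom_class[OF assms] word_val_append[OF c]
    by (auto simp: carrier_presented presented_group_mult)
qed

end

text \<open>A homomorphism is evaluated on a word letter by letter, so it is determined by its values on
  the generators.\<close>

lemma hom_word_class:
  assumes G: "group G" and \<phi>: "\<phi> \<in> hom (presented_group S R) G" and u: "u \<in> words S"
  shows "\<phi> (word_class S R u) = word_val G (\<lambda>x\<in>S. \<phi> (word_class S R (letter x))) u"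
  using u
proof (induction u)
  interpret group_hom "presented_group S R" G \<phi>
    using G \<phi> by (simp add: group_hom_def group_hom_axioms_def group_presented_group)
  let ?c = "\<lambda>x\<in>S. \<phi> (word_class S R (letter x))"
  have car: "word_class S R w \<in> carrier (presented_group S R)" if "w \<in> words S" for w
    using that by (auto simp: carrier_presented)
  {
    case Nil
    have "\<phi> \<one>\<^bsub>presented_group S R\<^esub> = \<one>\<^bsub>G\<^esub>" by (rule hom_one)
    then show ?case by (simp add: one_presented)
  next
    case (Cons p u)
    obtain x b where p: "p = (x, b)" by fastforce
    with Cons.prems have x: "x \<in> S" and u: "u \<in> words S" by auto
    have "word_class S R [(x, False)] \<otimes>\<^bsub>presented_group S R\<^esub> word_class S R (letter x) =
        \<one>\<^bsub>presented_group S R\<^esub>"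
      using x pres_eq.cancel[of x S R False]
      by (simp add: presented_group_mult letter_def word_class_eq_iff one_presented)
    then have "word_class S R [(x, False)] = inv\<^bsub>presented_group S R\<^esub> word_class S R (letter x)"
      using x car by (intro G.inv_equality[symmetric]) auto
    then have "\<phi> (word_class S R [(x, b)]) = (if b then ?c x else inv\<^bsub>G\<^esub> ?c x)"
      using x car by (cases b) (auto simp: letter_def)
    moreover have "word_class S R (p # u) = word_class S R [(x, b)] \<otimes>\<^bsub>presented_group S R\<^esub> word_class S R u"
      using x u by (simp add: p presented_group_mult)
    ultimately show ?case
      using Cons.IH[OF u] x u car by (simp add: p H.word_val_Cons)
  }
qed

text \<open>
  The universal property, restricted to epimorphisms: the image of a homomorphism is the set of
  values of words, which is the subgroup generated by the values of the letters.  Extensionality on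
  both sides makes restriction to the generators injective.
\<close>

theorem bij_betw_epis_tuples:
  fixes G (structure)
  assumes G: "group G"
  shows "bij_betw (\<lambda>\<phi>. \<lambda>x\<in>S. \<phi> (word_class S R (letter x)))
           (epi (presented_group S R) G \<inter> extensional (carrier (presented_group S R)))
           {c \<in> generating_tuples G S. satisfies G S R c}"
proof -
  interpret group G by fact
  let ?P = "presented_group S R"
  let ?res = "\<lambda>\<phi>. \<lambda>x\<in>S. \<phi> (word_class S R (letter x))"
  have res_Pi: "?res \<phi> \<in> S \<rightarrow> carrier G" if "\<phi> \<in> hom ?P G" for \<phi>
  proof -
    have "word_class S R (letter x) \<in> carrier ?P" if "x \<in> S" for x
      using that by (auto simp: carrier_presented)
    then show ?thesis using that by (auto simp: hom_def)
  qed
  have vals: "word_val G c ` words S = generate G (c ` S)" if c: "c \<in> S \<rightarrow> carrier G" for c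
  proof (rule generateI)
    show "subgroup (word_val G c ` words S) G"
    proof (rule subgroup.intro)
      show "word_val G c ` words S \<subseteq> carrier G" using word_val_closed[OF c] by blast
      show "\<one> \<in> word_val G c ` words S" by (rule image_eqI[of _ _ "[]"]) simp_all
    next
      fix x y assume "x \<in> word_val G c ` words S" "y \<in> word_val G c ` words S"
      then obtain u v where uv: "x = word_val G c u" "u \<in> words S" "y = word_val G c v" "v \<in> words S"
        by blast
      then have "x \<otimes> y = word_val G c (u @ v)" by (simp add: word_val_append[OF c])
      moreover have "u @ v \<in> words S" using uv by simp
      ultimately show "x \<otimes> y \<in> word_val G c ` words S" by blast
      have "inv x = word_val G c (winv u)" using uv by (simp add: word_val_winv[OF c])
      moreover have "winv u \<in> words S" using uv by simp
      ultimately show "inv x \<in> word_val G c ` words S" by blast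
    qed
    show "c ` S \<subseteq> word_val G c ` words S"
    proof
      fix y assume "y \<in> c ` S"
      then obtain x where x: "x \<in> S" "y = c x" by blast
      then have "y = word_val G c (letter x)" "letter x \<in> words S"
        using word_val_letter[of c x] Pi_mem[OF c, of x] by auto
      then show "y \<in> word_val G c ` words S" by blast
    qed
    fix K assume K: "subgroup K G" "c ` S \<subseteq> K"
    have K': "c x \<in> K" if "x \<in> S" for x
      using K(2) that by blast
    have "word_val G c u \<in> K" if "u \<in> words S" for u
      using that
      by (induction u)
        (auto simp: word_val_Cons subgroup.one_closed[OF K(1)] K'
          intro!: subgroup.m_closed[OF K(1)] subgroup.m_inv_closed[OF K(1)])
    then show "word_val G c ` words S \<subseteq> K" by blast
  qed
  have img: "\<phi> ` carrier ?P = generate G (?res \<phi> ` S)" if "\<phi> \<in> hom ?P G" for \<phi>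
  proof -
    have "\<phi> ` carrier ?P = (\<lambda>u. \<phi> (word_class S R u)) ` words S"
      by (auto simp: presented_group_def)
    also have "\<dots> = word_val G (?res \<phi>) ` words S"
      using hom_word_class[OF G that] by (intro image_cong) auto
    finally show ?thesis using vals[OF res_Pi[OF that]] by simp
  qed
  have sat: "satisfies G S R (?res \<phi>)" if \<phi>: "\<phi> \<in> hom ?P G" for \<phi>
    unfolding satisfies_def
  proof (clarify)
    fix u v assume uv: "(u, v) \<in> R" "u \<in> words S" "v \<in> words S"
    then have "word_class S R u = word_class S R v"
      by (simp add: word_class_eq_iff pres_eq.relation)
    then show "word_val G (?res \<phi>) u = word_val G (?res \<phi>) v"
      using hom_word_class[OF G \<phi>] uv by metis
  qed
  have section_eq: "?res (tuple_hom G S R c) = c" if "c \<in> S \<rightarrow>\<^sub>E carrier G" "satisfies G S R c" for c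
  proof
    fix x show "?res (tuple_hom G S R c) x = c x"
    proof (cases "x \<in> S")
      case True
      then have "c \<in> S \<rightarrow> carrier G" "c x \<in> carrier G" using that by (auto simp: PiE_def Pi_iff)
      then show ?thesis using that True by (simp add: tuple_hom_class word_val_letter)
    qed (use that in auto)
  qed
  show ?thesis
  proof (rule bij_betwI[where g = "tuple_hom G S R"])
    show "?res \<in> epi ?P G \<inter> extensional (carrier ?P) \<rightarrow> {c \<in> generating_tuples G S. satisfies G S R c}"
    proof
      fix \<phi> assume "\<phi> \<in> epi ?P G \<inter> extensional (carrier ?P)"
      then have \<phi>: "\<phi> \<in> hom ?P G" "\<phi> ` carrier ?P = carrier G" by (auto simp: epi_def)
      then show "?res \<phi> \<in> {c \<in> generating_tuples G S. satisfies G S R c}"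
        using img[OF \<phi>(1)] sat[OF \<phi>(1)] res_Pi[OF \<phi>(1)]
        by (auto simp: generating_tuples_def Pi_iff)
    qed
    show "tuple_hom G S R \<in> {c \<in> generating_tuples G S. satisfies G S R c} \<rightarrow> epi ?P G \<inter> extensional (carrier ?P)"
    proof
      fix c assume "c \<in> {c \<in> generating_tuples G S. satisfies G S R c}"
      then have c: "c \<in> S \<rightarrow>\<^sub>E carrier G" "generate G (c ` S) = carrier G" "satisfies G S R c"
        by (auto simp: generating_tuples_def)
      have h: "tuple_hom G S R c \<in> hom ?P G" using c by (intro tuple_hom_hom) auto
      show "tuple_hom G S R c \<in> epi ?P G \<inter> extensional (carrier ?P)"
        using h img[OF h] section_eq[OF c(1,3)] c(2) by (simp add: epi_def) (simp add: tuple_hom_def)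
    qed
  next
    fix \<phi> assume "\<phi> \<in> epi ?P G \<inter> extensional (carrier ?P)"
    then have \<phi>: "\<phi> \<in> hom ?P G" "\<phi> \<in> extensional (carrier ?P)" by (auto simp: epi_def)
    show "tuple_hom G S R (?res \<phi>) = \<phi>"
    proof
      fix P show "tuple_hom G S R (?res \<phi>) P = \<phi> P"
      proof (cases "P \<in> carrier ?P")
        case True
        then obtain u where "u \<in> words S" "P = word_class S R u" by (auto simp: carrier_presented)
        then show ?thesis
          using tuple_hom_class[OF res_Pi[OF \<phi>(1)] sat[OF \<phi>(1)], of u] hom_word_class[OF G \<phi>(1), of u] by simp
      next
        case False
        then show ?thesis using \<phi>(2) by (simp add: tuple_hom_def extensional_def)
      qed
    qed
  next
    fix c assume "c \<in> {c \<in> generating_tuples G S. satisfies G S R c}"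
    then show "?res (tuple_hom G S R c) = c" by (intro section_eq) (auto simp: generating_tuples_def)
  qed
qed

lemma bij_betw_epi_iso:
  assumes B: "group B" "group G" "group H" and h: "h \<in> iso G H"
  shows "bij_betw (compose (carrier B) h)
           (epi B G \<inter> extensional (carrier B)) (epi B H \<inter> extensional (carrier B))"
proof -
  define k where "k = inv_into (carrier G) h"
  have k: "k \<in> iso H G" unfolding k_def by (rule group.iso_set_sym[OF B(2) h])
  have hk: "h (k y) = y" if "y \<in> carrier H" for y
    using that h unfolding k_def iso_def bij_betw_def by (auto simp: f_inv_into_f)
  have kh: "k (h x) = x" if "x \<in> carrier G" for x
    using that h unfolding k_def iso_def bij_betw_def by (auto simp: inv_into_f_f)
  have closed: "compose (carrier B) f \<phi> \<in> epi B K' \<inter> extensional (carrier B)"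
    if "f \<in> iso K K'" "\<phi> \<in> epi B K" for f K K' \<phi>
  proof -
    have "f \<in> epi K K'" using that by (simp add: iso_iff_mon_epi)
    then have "f \<circ> \<phi> \<in> epi B K'" using that(2) epi_compose by blast
    then have "compose (carrier B) f \<phi> \<in> epi B K'"
      using B(1) by (auto simp: epi_def hom_def compose_def Pi_iff image_def group.is_monoid monoid.m_closed)
    then show ?thesis by (simp add: compose_def)
  qed
  show ?thesis
  proof (rule bij_betwI[where g = "compose (carrier B) k"])
    show "compose (carrier B) h \<in> epi B G \<inter> extensional (carrier B) \<rightarrow> epi B H \<inter> extensional (carrier B)"
      using closed[OF h] by auto
    show "compose (carrier B) k \<in> epi B H \<inter> extensional (carrier B) \<rightarrow> epi B G \<inter> extensional (carrier B)"
      using closed[OF k] by auto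
  next
    fix \<phi> assume "\<phi> \<in> epi B G \<inter> extensional (carrier B)"
    then show "compose (carrier B) k (compose (carrier B) h \<phi>) = \<phi>"
      by (auto simp: compose_def fun_eq_iff epi_def hom_def Pi_iff kh extensional_def)
  next
    fix \<phi> assume "\<phi> \<in> epi B H \<inter> extensional (carrier B)"
    then show "compose (carrier B) h (compose (carrier B) k \<phi>) = \<phi>"
      by (auto simp: compose_def fun_eq_iff epi_def hom_def Pi_iff hk extensional_def)
  qed
qed


section \<open>Orbits of admissible epimorphisms\<close>

text \<open>
  In a free action every stabiliser is trivial, so by the orbit-stabiliser theorem all orbits have
  the size of the group.
\<close>

lemma (in group_action) card_orbits_free:
  assumes fin: "finite E"
    and free: "\<And>x g. x \<in> E \<Longrightarrow> g \<in> carrier G \<Longrightarrow> \<phi> g x = x \<Longrightarrow> g = \<one>"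
  shows "card (orbits G E \<phi>) * order G = card E"
proof -
  interpret G: group G using group_hom group_hom.axioms(1) by auto
  have "card (orbit G \<phi> x) = order G" if "x \<in> E" for x
  proof -
    have "stabilizer G \<phi> x = {\<one>}"
      using free[OF that] subgroup.one_closed[OF stabilizer_subgroup[OF that]]
      by (auto simp: stabilizer_def)
    then show ?thesis using orbit_stabilizer_theorem[OF that] by simp
  qed
  then have "(\<Sum>T\<in>orbits G E \<phi>. card T) = (\<Sum>T\<in>orbits G E \<phi>. order G)"
    by (intro sum.cong) (auto simp: orbits_def)
  moreover have "(\<Sum>T\<in>orbits G E \<phi>. card T) = card E"
    using disjoint_sum[OF fin, of "\<lambda>_. 1 :: nat"] by simp
  ultimately show ?thesis by simp
qed

text \<open>An automorphism that fixes an epimorphism is the identity on its image.\<close>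

lemma card_orbits_admissible:
  assumes "group G" and "finite (admissible_epis g G)"
  shows "num_admissible_epis_mod_aut g G * order (AutoGroup G) = num_admissible_epis g G"
proof -
  interpret group_action "AutoGroup G" "admissible_epis g G" "aut_postcomp g G"
    by (rule group_action_aut_postcomp[OF assms(1)])
  show ?thesis
    unfolding num_admissible_epis_mod_aut_def num_admissible_epis_def
  proof (rule card_orbits_free[OF assms(2)])
    fix \<phi> \<alpha> assume \<phi>: "\<phi> \<in> admissible_epis g G" and \<alpha>: "\<alpha> \<in> carrier (AutoGroup G)"
      and eq: "aut_postcomp g G \<alpha> \<phi> = \<phi>"
    have "\<alpha> y = y" if "y \<in> carrier G" for y
    proof -
      have "y \<in> \<phi> ` carrier (braid_group g)"
        using that \<phi> by (auto simp: admissible_epis_def epi_def)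
      then obtain x where x: "x \<in> carrier (braid_group g)" "y = \<phi> x" by blast
      have "compose (carrier (braid_group g)) \<alpha> \<phi> x = \<phi> x"
        using eq \<phi> by (simp add: aut_postcomp_def)
      then show ?thesis using x by (simp add: compose_eq)
    qed
    moreover have "\<alpha> \<in> extensional (carrier G)"
      using \<alpha> by (auto simp: AutoGroup_def auto_def Bij_def)
    ultimately have "\<alpha> = (\<lambda>x\<in>carrier G. x)" by (auto simp: fun_eq_iff extensional_def)
    then show "\<alpha> = \<one>\<^bsub>AutoGroup G\<^esub>" by (simp add: AutoGroup_def BijGroup_def)
  qed
qed

text \<open>A surjective self-map of a finite set is bijective, so automorphisms fall under the count of
  epimorphisms out of a presented group.\<close>

lemma auto_finite:
  assumes "finite (carrier G)"
  shows "auto G = epi G G \<inter> extensional (carrier G)"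
  using assms
  by (auto simp: auto_def Bij_def epi_def bij_betw_def intro: eq_card_imp_inj_on)


section \<open>A concrete model of the dihedral group\<close>

text \<open>The pair \<open>(e, j)\<close> stands for the normal form \<open>x\<^sup>e y\<^sup>j\<close>; moving \<open>x\<close> to the left past \<open>y\<^sup>j\<close>
  negates \<open>j\<close>.\<close>

definition dih :: "nat \<Rightarrow> (bool \<times> int) monoid" where
  "dih m =
     \<lparr> carrier = UNIV \<times> {0..<int m},
       monoid.mult = (\<lambda>(e, j) (f, k). (e \<noteq> f, ((if f then - j else j) + k) mod int m)),
       monoid.one = (False, 0) \<rparr>"

lemma carrier_dih: "carrier (dih m) = UNIV \<times> {0..<int m}"
  by (simp add: dih_def)

lemma mult_dih [simp]:
  "(e, j) \<otimes>\<^bsub>dih m\<^esub> (f, k) = (e \<noteq> f, ((if f then - j else j) + k) mod int m)"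
  by (simp add: dih_def)

lemma one_dih [simp]: "\<one>\<^bsub>dih m\<^esub> = (False, 0)"
  by (simp add: dih_def)

lemma group_dih:
  assumes "m > 0"
  shows "group (dih m)"
proof (rule groupI)
  fix x y z assume "x \<in> carrier (dih m)" "y \<in> carrier (dih m)" "z \<in> carrier (dih m)"
  show "x \<otimes>\<^bsub>dih m\<^esub> y \<otimes>\<^bsub>dih m\<^esub> z = x \<otimes>\<^bsub>dih m\<^esub> (y \<otimes>\<^bsub>dih m\<^esub> z)"
    by (cases x; cases y; cases z) (auto simp: mod_simps algebra_simps)
next
  fix x assume x: "x \<in> carrier (dih m)"
  obtain e j where e: "x = (e, j)" by fastforce
  show "\<exists>y\<in>carrier (dih m). y \<otimes>\<^bsub>dih m\<^esub> x = \<one>\<^bsub>dih m\<^esub>"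
    using x assms
    by (intro bexI[of _ "(e, (if e then j else - j) mod int m)"]) (auto simp: e carrier_dih mod_simps)
qed (use assms in \<open>auto simp: carrier_dih\<close>)

lemma inv_dih:
  assumes "m > 0" "(e, j) \<in> carrier (dih m)"
  shows "inv\<^bsub>dih m\<^esub> (e, j) = (e, (if e then j else - j) mod int m)"
  using assms by (intro group.inv_equality group_dih) (auto simp: carrier_dih mod_simps)

lemma pow_dih:
  assumes "m > 0"
  shows "(False, j) [^]\<^bsub>dih m\<^esub> (n::nat) = (False, (int n * j) mod int m)"
proof -
  interpret group "dih m" by (rule group_dih[OF assms])
  show ?thesis by (induction n) (auto simp: mod_simps algebra_simps)
qed

lemma int_pow_dih:
  assumes "m > 0" "j \<in> {0..<int m}"
  shows "(False, j) [^]\<^bsub>dih m\<^esub> (i::int) = (False, (i * j) mod int m)"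
proof -
  interpret group "dih m" by (rule group_dih[OF assms(1)])
  show ?thesis
  proof (cases i rule: int_cases2)
    case (nonneg n)
    then show ?thesis by (simp add: int_pow_int pow_dih assms)
  next
    case (nonpos n)
    have c: "(False, (int n * j) mod int m) \<in> carrier (dih m)" using assms by (simp add: carrier_dih)
    have "(False, j) [^]\<^bsub>dih m\<^esub> i = inv\<^bsub>dih m\<^esub> (False, (int n * j) mod int m)"
      using assms by (simp add: nonpos int_pow_neg int_pow_int pow_dih carrier_dih)
    also have "\<dots> = (False, (i * j) mod int m)"
      using inv_dih[OF assms(1) c] by (simp add: nonpos mod_simps)
    finally show ?thesis .
  qed
qed

text \<open>Conjugation by \<open>x\<close> is an endomorphism, so it inverts all powers of \<open>y\<close> once it inverts \<open>y\<close>.\<close>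

lemma (in group) int_pow_inverted:
  assumes "x \<in> carrier G" "y \<in> carrier G" "x \<otimes> y \<otimes> inv x = inv y"
  shows "x \<otimes> y [^] (i::int) = y [^] (- i) \<otimes> x"
proof -
  interpret h: group_hom G G "\<lambda>z. x \<otimes> z \<otimes> inv x"
  proof (unfold_locales, rule homI)
    fix u v assume uv: "u \<in> carrier G" "v \<in> carrier G"
    have "inv x \<otimes> (x \<otimes> w) = w" if "w \<in> carrier G" for w
      using that assms(1) by (simp add: m_assoc[symmetric])
    then show "x \<otimes> (u \<otimes> v) \<otimes> inv x = x \<otimes> u \<otimes> inv x \<otimes> (x \<otimes> v \<otimes> inv x)"
      using uv assms(1) by (simp add: m_assoc)
  qed (use assms in auto)
  have "x \<otimes> y [^] i \<otimes> inv x = (inv y) [^] i"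
    using h.hom_int_pow[of y i] assms by simp
  also have "\<dots> = y [^] (- i)" using assms(2) by (simp add: int_pow_neg int_pow_inv)
  finally have "x \<otimes> y [^] i \<otimes> inv x \<otimes> x = y [^] (- i) \<otimes> x" by simp
  then show ?thesis using assms by (simp add: m_assoc)
qed

lemma (in group) word_val_replicate:
  assumes "c y \<in> carrier G"
  shows "word_val G c (concat (replicate n (letter y))) = c y [^] n"
proof (induction n)
  case (Suc n)
  then show ?case using Suc assms nat_pow_Suc2[OF assms, of n] by (simp add: word_val_Cons letter_def)
qed simp

lemma words_replicate: "concat (replicate n (letter y)) \<in> words S" if "y \<in> S"
  using that by (induction n) auto

lemma (in group) satisfies_dihedral_rels:
  assumes c: "c \<in> {Gen_x, Gen_y} \<rightarrow> carrier G"
  shows "satisfies G {Gen_x, Gen_y} (dihedral_rels m) c \<longleftrightarrow>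
    c Gen_x \<otimes> c Gen_x = \<one> \<and> c Gen_y [^] m = \<one> \<and> c Gen_x \<otimes> c Gen_y \<otimes> inv c Gen_x = inv c Gen_y"
proof -
  let ?S = "{Gen_x, Gen_y}"
  have car: "c Gen_x \<in> carrier G" "c Gen_y \<in> carrier G" using c by auto
  have W: "letter Gen_x \<in> words ?S" "letter Gen_y \<in> words ?S" by auto
  show ?thesis
    using car W words_replicate[of Gen_y ?S m]
    by (simp add: satisfies_def dihedral_rels_def word_val_append[OF c] word_val_winv[OF c]
        word_val_letter word_val_replicate m_assoc)
qed

text \<open>
  The relations allow every element to be brought to the form \<open>x\<^sup>e y\<^sup>j\<close>, and no two of these \<open>2m\<close>
  forms agree because the model, which satisfies the relations, tells them apart.
\<close>

theorem dihedral_group_iso_dih: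
  assumes m: "m > 0"
  shows "\<exists>h. h \<in> iso (dihedral_group m) (dih m)"
proof -
  let ?S = "{Gen_x, Gen_y}" and ?R = "dihedral_rels m"
  interpret H: group "dih m" by (rule group_dih[OF m])
  interpret D: group "dihedral_group m" by (rule group_dihedral_group)
  define rx where "rx = word_class ?S ?R (letter Gen_x)"
  define ry where "ry = word_class ?S ?R (letter Gen_y)"
  have XY: "rx \<in> carrier (dihedral_group m)" "ry \<in> carrier (dihedral_group m)"
    by (auto simp: rx_def ry_def dihedral_group_def carrier_presented)
  define d where "d = (\<lambda>s\<in>?S. case s of Gen_x \<Rightarrow> rx | Gen_y \<Rightarrow> ry)"
  have "(\<lambda>P\<in>carrier (dihedral_group m). P) \<in>
      epi (presented_group ?S ?R) (dihedral_group m) \<inter> extensional (carrier (presented_group ?S ?R))"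
    by (auto simp: epi_def hom_def dihedral_group_def[symmetric] image_def)
  then have "(\<lambda>s\<in>?S. (\<lambda>P\<in>carrier (dihedral_group m). P) (word_class ?S ?R (letter s)))
      \<in> {c \<in> generating_tuples (dihedral_group m) ?S. satisfies (dihedral_group m) ?S ?R c}"
    by (rule bij_betwE[OF bij_betw_epis_tuples[OF group_dihedral_group], rule_format])
  also have "(\<lambda>s\<in>?S. (\<lambda>P\<in>carrier (dihedral_group m). P) (word_class ?S ?R (letter s))) = d"
    using XY by (auto simp: d_def rx_def ry_def fun_eq_iff)
  finally have d: "d \<in> generating_tuples (dihedral_group m) ?S" "satisfies (dihedral_group m) ?S ?R d"
    by auto
  have dc: "d \<in> ?S \<rightarrow> carrier (dihedral_group m)" "d Gen_x = rx" "d Gen_y = ry"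
    using XY by (auto simp: d_def)
  have rel: "rx \<otimes>\<^bsub>dihedral_group m\<^esub> rx = \<one>\<^bsub>dihedral_group m\<^esub>"
    "ry [^]\<^bsub>dihedral_group m\<^esub> m = \<one>\<^bsub>dihedral_group m\<^esub>"
    "rx \<otimes>\<^bsub>dihedral_group m\<^esub> ry \<otimes>\<^bsub>dihedral_group m\<^esub> inv\<^bsub>dihedral_group m\<^esub> rx = inv\<^bsub>dihedral_group m\<^esub> ry"
    using d(2) D.satisfies_dihedral_rels[OF dc(1), of m] by (simp_all add: dc)
  have gen: "generate (dihedral_group m) {rx, ry} = carrier (dihedral_group m)"
    using d(1) by (simp add: generating_tuples_def dc)
  \<comment> \<open>The inverse isomorphism is the evaluation of normal forms.\<close>
  define \<psi> where "\<psi> = (\<lambda>(e, j). (if e then rx else \<one>\<^bsub>dihedral_group m\<^esub>) \<otimes>\<^bsub>dihedral_group m\<^esub> ry [^]\<^bsub>dihedral_group m\<^esub> (j::int))"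
  have Ymod: "ry [^]\<^bsub>dihedral_group m\<^esub> (j mod int m) = ry [^]\<^bsub>dihedral_group m\<^esub> j" for j
  proof -
    have "ry [^]\<^bsub>dihedral_group m\<^esub> (int m * (j div int m)) = \<one>\<^bsub>dihedral_group m\<^esub>"
      using XY rel(2) by (simp add: D.int_pow_pow[symmetric] int_pow_int)
    moreover have "ry [^]\<^bsub>dihedral_group m\<^esub> j =
        ry [^]\<^bsub>dihedral_group m\<^esub> (int m * (j div int m)) \<otimes>\<^bsub>dihedral_group m\<^esub> ry [^]\<^bsub>dihedral_group m\<^esub> (j mod int m)"
      using XY by (subst D.int_pow_mult[symmetric]) auto
    ultimately show ?thesis using XY by simp
  qed
  have YX: "ry [^]\<^bsub>dihedral_group m\<^esub> j \<otimes>\<^bsub>dihedral_group m\<^esub> rx = rx \<otimes>\<^bsub>dihedral_group m\<^esub> ry [^]\<^bsub>dihedral_group m\<^esub> (- j)" for j :: int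
    using D.int_pow_inverted[OF XY rel(3), of "- j"] by simp
  have \<psi>: "\<psi> \<in> hom (dih m) (dihedral_group m)"
  proof (rule homI)
    fix p q assume "p \<in> carrier (dih m)" "q \<in> carrier (dih m)"
    obtain e j f k where pq: "p = (e, j)" "q = (f, k)" by fastforce
    have XX: "rx \<otimes>\<^bsub>dihedral_group m\<^esub> (rx \<otimes>\<^bsub>dihedral_group m\<^esub> z) = z" if "z \<in> carrier (dihedral_group m)" for z
      using that XY rel(1) by (simp add: D.m_assoc[symmetric])
    have YXZ: "ry [^]\<^bsub>dihedral_group m\<^esub> j \<otimes>\<^bsub>dihedral_group m\<^esub> (rx \<otimes>\<^bsub>dihedral_group m\<^esub> z) =
        rx \<otimes>\<^bsub>dihedral_group m\<^esub> (ry [^]\<^bsub>dihedral_group m\<^esub> (- j) \<otimes>\<^bsub>dihedral_group m\<^esub> z)"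
      if "z \<in> carrier (dihedral_group m)" for j :: int and z
      using that XY YX[of j] by (simp add: D.m_assoc[symmetric])
    show "\<psi> (p \<otimes>\<^bsub>dih m\<^esub> q) = \<psi> p \<otimes>\<^bsub>dihedral_group m\<^esub> \<psi> q"
      using XY by (cases e; cases f)
        (simp_all add: \<psi>_def pq Ymod D.int_pow_mult[symmetric] D.m_assoc XX YXZ)
  next
    fix p assume "p \<in> carrier (dih m)"
    then show "\<psi> p \<in> carrier (dihedral_group m)" using XY by (auto simp: \<psi>_def split: prod.split)
  qed
  interpret \<psi>: group_hom "dih m" "dihedral_group m" \<psi> by unfold_locales (rule \<psi>)
  have "subgroup (\<psi> ` carrier (dih m)) (dihedral_group m)" by (rule \<psi>.img_is_subgroup)
  moreover have "{rx, ry} \<subseteq> \<psi> ` carrier (dih m)"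
  proof -
    have "\<psi> (True, 0) = rx" "\<psi> (False, 1 mod int m) = ry" using XY by (simp_all add: \<psi>_def Ymod)
    moreover have "(True, 0) \<in> carrier (dih m)" "(False, 1 mod int m) \<in> carrier (dih m)"
      using m by (auto simp: carrier_dih)
    ultimately show ?thesis by (metis empty_subsetI image_eqI insert_subset)
  qed
  ultimately have "carrier (dihedral_group m) \<subseteq> \<psi> ` carrier (dih m)"
    using D.generate_subgroup_incl gen by metis
  then have surj: "\<psi> ` carrier (dih m) = carrier (dihedral_group m)"
    using \<psi> by (auto simp: hom_def)
  \<comment> \<open>Evaluation is injective because the model satisfies the relations.\<close>
  define c where "c = (\<lambda>s. case s of Gen_x \<Rightarrow> (True, 0) | Gen_y \<Rightarrow> (False, 1 mod int m))"
  have c: "c \<in> ?S \<rightarrow> carrier (dih m)" using m by (auto simp: c_def carrier_dih)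
  have sat: "satisfies (dih m) ?S ?R c"
    using m by (subst H.satisfies_dihedral_rels[OF c])
      (auto simp: c_def pow_dih inv_dih carrier_dih mod_simps)
  define \<phi> where "\<phi> = tuple_hom (dih m) ?S ?R c"
  have \<phi>: "\<phi> \<in> hom (dihedral_group m) (dih m)"
    unfolding \<phi>_def dihedral_group_def by (rule H.tuple_hom_hom[OF c sat])
  interpret \<phi>: group_hom "dihedral_group m" "dih m" \<phi> by unfold_locales (rule \<phi>)
  have "\<phi> rx = (True, 0)" "\<phi> ry = (False, 1 mod int m)"
    using c unfolding \<phi>_def rx_def ry_def
    by (auto simp: H.tuple_hom_class[OF c sat] H.word_val_letter) (auto simp: c_def)
  then have inv: "\<phi> (\<psi> p) = p" if "p \<in> carrier (dih m)" for p
    using that XY m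
    by (cases p) (auto simp: \<psi>_def \<phi>.hom_int_pow int_pow_dih carrier_dih mod_simps)
  have "inj_on \<psi> (carrier (dih m))" by (rule inj_on_inverseI[of _ \<phi>]) (rule inv)
  then have "\<psi> \<in> iso (dih m) (dihedral_group m)"
    using \<psi> surj by (simp add: iso_def bij_betw_def)
  then show ?thesis using H.iso_set_sym by blast
qed


section \<open>Coordinates relative to a reflection\<close>

text \<open>
  With \<open>s = (True, k)\<close> a reflection, this is \<open>s\<^sup>e y\<^sup>t\<close>.  In these coordinates the multiplication does
  not depend on \<open>k\<close>, so all reflections can be treated alike, and \<open>k = 0\<close> gives back the normal
  form.
\<close>

definition refl_coord :: "nat \<Rightarrow> int \<Rightarrow> bool \<Rightarrow> int \<Rightarrow> bool \<times> int" where
  "refl_coord m k e t = (e, ((if e then k else 0) + t) mod int m)"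

lemma refl_coord_closed [simp]: "m > 0 \<Longrightarrow> refl_coord m k e t \<in> carrier (dih m)"
  by (simp add: refl_coord_def carrier_dih)

lemma fst_refl_coord [simp]: "fst (refl_coord m k e t) = e"
  by (simp add: refl_coord_def)

lemma refl_coord_mult [simp]:
  "refl_coord m k e t \<otimes>\<^bsub>dih m\<^esub> refl_coord m k f u = refl_coord m k (e \<noteq> f) ((if f then - t else t) + u)"
  by (auto simp: refl_coord_def mod_simps algebra_simps)

lemma refl_coord_eq_iff [simp]:
  "refl_coord m k e t = refl_coord m k f u \<longleftrightarrow> e = f \<and> int m dvd t - u"
proof -
  have "((if e then k else 0) + t) mod int m = ((if e then k else 0) + u) mod int m \<longleftrightarrow> int m dvd t - u"
    by (simp add: mod_eq_dvd_iff)
  then show ?thesis by (auto simp: refl_coord_def)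
qed

lemma one_refl_coord: "\<one>\<^bsub>dih m\<^esub> = refl_coord m k False 0"
  by (simp add: refl_coord_def)

lemma refl_coord_inv [simp]:
  assumes "m > 0"
  shows "inv\<^bsub>dih m\<^esub> refl_coord m k e t = refl_coord m k e (if e then t else - t)"
  by (rule group.inv_equality[OF group_dih[OF assms]])
    (simp_all add: assms one_refl_coord[of m k] del: one_dih)

lemma refl_coord_cases:
  assumes "p \<in> carrier (dih m)"
  obtains e t where "t \<in> {0..<int m}" "p = refl_coord m k e t"
proof -
  obtain e j where p: "p = (e, j)" "j \<in> {0..<int m}" using assms by (auto simp: carrier_dih)
  show ?thesis
    by (rule that[of "(j - (if e then k else 0)) mod int m" e]) (use p in \<open>auto simp: refl_coord_def mod_simps\<close>)
qed

text \<open>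
  Both products have the same first coordinate; their exponents differ by twice the part of each
  exponent that the other element negates.
\<close>

lemma refl_coord_commute_iff:
  assumes "m > 0"
  shows "refl_coord m k e t \<otimes>\<^bsub>dih m\<^esub> refl_coord m k f u = refl_coord m k f u \<otimes>\<^bsub>dih m\<^esub> refl_coord m k e t
    \<longleftrightarrow> int m dvd 2 * ((if f then t else 0) - (if e then u else 0))"
  by (auto simp: dvd_diff_commute[of _ "2 * t"] intro: arg_cong[of _ _ "(dvd) (int m)"] iffD1[OF dvd_minus_iff])

section \<open>Generating tuples\<close>

lemma inv_integer_mod_group_mod:
  "m > 0 \<Longrightarrow> z \<in> {0..<int m} \<Longrightarrow> inv\<^bsub>integer_mod_group m\<^esub> z = (- z) mod int m"
  by (intro group.inv_equality) (auto simp: carrier_integer_mod_group mod_simps)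

lemma subgroup_integer_mod_groupI:
  assumes "m > 0" "A \<subseteq> {0..<int m}" "0 \<in> A"
    and "\<And>y z. y \<in> A \<Longrightarrow> z \<in> A \<Longrightarrow> (y + z) mod int m \<in> A"
    and "\<And>z. z \<in> A \<Longrightarrow> (- z) mod int m \<in> A"
  shows "subgroup A (integer_mod_group m)"
proof (rule subgroup.intro)
  fix z assume "z \<in> A"
  then show "inv\<^bsub>integer_mod_group m\<^esub> z \<in> A"
    using assms inv_integer_mod_group_mod[of m z] by (metis subsetD)
qed (use assms in \<open>auto simp: carrier_integer_mod_group\<close>)

text \<open>
  Together with the reflection \<open>s\<close>, a group \<open>A\<close> of rotations generates \<open>A \<union> s A\<close>, because \<open>s\<close>
  normalises \<open>A\<close>.
\<close>

lemma subgroup_refl_coord: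
  assumes m: "m > 0" and A: "subgroup A (integer_mod_group m)"
  shows "subgroup {refl_coord m k e t | e t. t mod int m \<in> A} (dih m)" (is "subgroup ?D _")
proof (rule subgroup.intro)
  have sub: "A \<subseteq> {0..<int m}" using subgroup.subset[OF A] m by (simp add: carrier_integer_mod_group)
  have zero: "0 \<in> A" using subgroup.one_closed[OF A] by simp
  have add: "(y + z) mod int m \<in> A" if "y mod int m \<in> A" "z mod int m \<in> A" for y z
    using subgroup.m_closed[OF A that] by (simp add: mod_simps)
  have neg: "(- z) mod int m \<in> A" if "z mod int m \<in> A" for z
    using subgroup.m_inv_closed[OF A that] inv_integer_mod_group_mod[OF m, of "z mod int m"] m
    by (simp add: mod_simps)
  show "?D \<subseteq> carrier (dih m)" using m by auto
  show "\<one>\<^bsub>dih m\<^esub> \<in> ?D" using zero by (force simp: one_refl_coord[of m k] simp del: one_dih)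
  fix p q assume "p \<in> ?D" "q \<in> ?D"
  then obtain e t f u where pq: "p = refl_coord m k e t" "t mod int m \<in> A"
    "q = refl_coord m k f u" "u mod int m \<in> A" by blast
  show "p \<otimes>\<^bsub>dih m\<^esub> q \<in> ?D"
  proof -
    have "((if f then - t else t) + u) mod int m \<in> A" using add neg pq by simp
    then show ?thesis unfolding pq refl_coord_mult by blast
  qed
  show "inv\<^bsub>dih m\<^esub> p \<in> ?D"
  proof -
    have "(if e then t else - t) mod int m \<in> A" using neg pq by simp
    then show ?thesis unfolding pq refl_coord_inv[OF m] by blast
  qed
qed

text \<open>
  Multiplication by \<open>s\<close> turns \<open>s y\<^sup>t\<close> into \<open>y\<^sup>t\<close>, so the bits \<open>e\<close> do not change the subgroup
  generated by \<open>s\<close> and the other entries: it is \<open>A \<union> s A\<close> with \<open>A\<close> generated by the exponents.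
\<close>

theorem generate_dih_iff:
  assumes m: "m > 0" and t: "t \<in> I \<rightarrow> {0..<int m}"
  shows "generate (dih m) (insert (refl_coord m k True 0) ((\<lambda>i. refl_coord m k (e i) (t i)) ` I)) = carrier (dih m)
    \<longleftrightarrow> generate (integer_mod_group m) (t ` I) = carrier (integer_mod_group m)"
    (is "generate _ ?T = _ \<longleftrightarrow> generate _ ?A = _")
proof
  interpret H: group "dih m" by (rule group_dih[OF m])
  interpret Z: group "integer_mod_group m" by simp
  have carZ: "carrier (integer_mod_group m) = {0..<int m}" using m by (simp add: carrier_integer_mod_group)
  have A: "?A \<subseteq> carrier (integer_mod_group m)" using t by (auto simp: carZ)
  have T: "?T \<subseteq> carrier (dih m)" using m by auto
  {
    assume gen: "generate (dih m) ?T = carrier (dih m)"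
    let ?D = "{refl_coord m k e z | e z. z mod int m \<in> generate (integer_mod_group m) ?A}"
    have "subgroup ?D (dih m)" by (rule subgroup_refl_coord[OF m Z.generate_is_subgroup[OF A]])
    moreover have "?T \<subseteq> ?D"
    proof -
      have "t i mod int m \<in> generate (integer_mod_group m) ?A" if "i \<in> I" for i
      proof -
        have "t i \<in> {0..<int m}" using t that by auto
        then show ?thesis using that by (auto intro: generate.incl)
      qed
      moreover have "0 mod int m \<in> generate (integer_mod_group m) ?A"
        using generate.one[of "integer_mod_group m" ?A] by simp
      ultimately show ?thesis by blast
    qed
    ultimately have "generate (dih m) ?T \<subseteq> ?D" by (rule H.generate_subgroup_incl[rotated])
    then have "carrier (dih m) \<subseteq> ?D" unfolding gen .
    moreover have "refl_coord m k False z \<in> carrier (dih m)" for z using m by simp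
    ultimately have *: "refl_coord m k False z \<in> ?D" for z by blast
    have "z \<in> generate (integer_mod_group m) ?A" if "z \<in> {0..<int m}" for z
    proof -
      obtain z' where "z' mod int m \<in> generate (integer_mod_group m) ?A" "int m dvd z - z'"
        using *[of z] by auto
      moreover from this have "z mod int m = z' mod int m" by (simp add: mod_eq_dvd_iff)
      ultimately show ?thesis using that by auto
    qed
    then show "generate (integer_mod_group m) ?A = carrier (integer_mod_group m)"
      using Z.generate_incl[OF A] carZ by blast
  next
    assume gen: "generate (integer_mod_group m) ?A = carrier (integer_mod_group m)"
    let ?K = "generate (dih m) ?T"
    have K: "subgroup ?K (dih m)" by (rule H.generate_is_subgroup[OF T])
    have s: "refl_coord m k True 0 \<in> ?K" by (auto intro: generate.incl)
    define B where "B = {z \<in> {0..<int m}. refl_coord m k False z \<in> ?K}"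
    have md: "refl_coord m k f (z mod int m) = refl_coord m k f z" for f z
      by (simp add: refl_coord_def mod_simps)
    have "subgroup B (integer_mod_group m)"
    proof (rule subgroup_integer_mod_groupI[OF m])
      show "0 \<in> B" using m subgroup.one_closed[OF K] one_refl_coord[of m k] by (simp add: B_def del: one_dih)
      show "(y + z) mod int m \<in> B" if "y \<in> B" "z \<in> B" for y z
        using that m subgroup.m_closed[OF K, of "refl_coord m k False y" "refl_coord m k False z"]
        by (simp add: B_def md)
      show "(- z) mod int m \<in> B" if "z \<in> B" for z
        using that m subgroup.m_inv_closed[OF K, of "refl_coord m k False z"] by (simp add: B_def md)
    qed (auto simp: B_def)
    moreover have "?A \<subseteq> B"
    proof
      fix z assume "z \<in> ?A"
      then obtain i where i: "i \<in> I" "z = t i" by blast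
      have c: "refl_coord m k (e i) z \<in> ?K" using i by (auto intro: generate.incl)
      have "refl_coord m k False z \<in> ?K"
        using c subgroup.m_closed[OF K s c] by (cases "e i") auto
      then show "z \<in> B" using i t by (auto simp: B_def)
    qed
    ultimately have "{0..<int m} \<subseteq> B" using Z.generate_subgroup_incl gen carZ by metis
    then have F: "refl_coord m k False z \<in> ?K" if "z \<in> {0..<int m}" for z
      using that by (auto simp: B_def)
    have "p \<in> ?K" if "p \<in> carrier (dih m)" for p
      using that
    proof (cases rule: refl_coord_cases[where k = k])
      case (1 e z)
      then show ?thesis
        using F[of z] subgroup.m_closed[OF K s F[of z]] by (cases e) auto
    qed
    then show "?K = carrier (dih m)" using subgroup.subset[OF K] by blast
  }
qed

lemma annihilator_subgroup:
  assumes "m > 0"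
  shows "subgroup {z \<in> {0..<int m}. int m dvd q * z} (integer_mod_group m)"
proof (rule subgroup_integer_mod_groupI[OF assms])
  have md: "int m dvd q * (z mod int m) \<longleftrightarrow> int m dvd q * z" for z
    by (simp add: dvd_eq_mod_eq_0 mod_simps)
  show "(y + z) mod int m \<in> {z \<in> {0..<int m}. int m dvd q * z}"
    if "y \<in> {z \<in> {0..<int m}. int m dvd q * z}" "z \<in> {z \<in> {0..<int m}. int m dvd q * z}" for y z
    using that assms by (simp add: md distrib_left)
  show "(- z) mod int m \<in> {z \<in> {0..<int m}. int m dvd q * z}"
    if "z \<in> {z \<in> {0..<int m}. int m dvd q * z}" for z
    using that assms by (simp add: md)
qed (use assms in auto)

text \<open>
  The exponents killed by \<open>q\<close> form a subgroup; if it contains a generating tuple it contains 1.  This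
  is how congruences on a generating tuple bound \<open>m\<close>.
\<close>

lemma generating_integer_mod_annihilator:
  assumes m: "m > 0" and t: "t \<in> generating_tuples (integer_mod_group m) I"
    and q: "\<And>i. i \<in> I \<Longrightarrow> int m dvd q * t i"
  shows "int m dvd q"
proof -
  interpret Z: group "integer_mod_group m" by simp
  let ?B = "{z \<in> {0..<int m}. int m dvd q * z}"
  have "t ` I \<subseteq> ?B" using t q m by (auto simp: generating_tuples_def carrier_integer_mod_group)
  then have "generate (integer_mod_group m) (t ` I) \<subseteq> ?B"
    by (rule Z.generate_subgroup_incl[OF _ annihilator_subgroup[OF m]])
  then have "carrier (integer_mod_group m) \<subseteq> ?B" using t by (simp add: generating_tuples_def)
  moreover have "1 mod int m \<in> carrier (integer_mod_group m)" using m by (simp add: carrier_integer_mod_group)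
  ultimately have "int m dvd q * (1 mod int m)" by blast
  then show ?thesis by (simp add: dvd_eq_mod_eq_0 mod_simps)
qed

text \<open>
  The dihedral counterpart: if all entries lie in \<open>A \<union> s A\<close>, where \<open>A\<close> consists of the rotations
  killed by \<open>q\<close>, then all rotations are killed by \<open>q\<close>.
\<close>

lemma generating_dih_annihilator:
  assumes m: "m > 0" and c: "c \<in> generating_tuples (dih m) S"
    and q: "\<And>x. x \<in> S \<Longrightarrow> \<exists>e t. c x = refl_coord m k e t \<and> int m dvd q * t"
  shows "int m dvd q"
proof -
  interpret H: group "dih m" by (rule group_dih[OF m])
  let ?B = "{z \<in> {0..<int m}. int m dvd q * z}"
  let ?D = "{refl_coord m k e t | e t. t mod int m \<in> ?B}"
  have md: "int m dvd q * (z mod int m) \<longleftrightarrow> int m dvd q * z" for z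
    by (simp add: dvd_eq_mod_eq_0 mod_simps)
  have "c ` S \<subseteq> ?D" using q m by (fastforce simp: md)
  then have "generate (dih m) (c ` S) \<subseteq> ?D"
    by (rule H.generate_subgroup_incl[OF _ subgroup_refl_coord[OF m annihilator_subgroup[OF m]]])
  then have "carrier (dih m) \<subseteq> ?D" using c by (simp add: generating_tuples_def)
  then have "refl_coord m k False 1 \<in> ?D" using m by (meson refl_coord_closed subsetD)
  then obtain t where t: "int m dvd 1 - t" "int m dvd q * t" by (auto simp: md)
  have "q = q * (1 - t) + q * t" by (simp add: algebra_simps)
  then show ?thesis using t by (metis dvd_add dvd_mult)
qed

text \<open>
  The rotations form a proper subgroup.
\<close>

lemma generating_dih_reflection:
  assumes m: "m > 0" and c: "c \<in> generating_tuples (dih m) S"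
  shows "\<exists>x\<in>S. fst (c x)"
proof (rule ccontr)
  assume none: "\<not> (\<exists>x\<in>S. fst (c x))"
  interpret H: group "dih m" by (rule group_dih[OF m])
  have "subgroup ({False} \<times> {0..<int m}) (dih m)"
    by (rule subgroup.intro) (use m in \<open>auto simp: carrier_dih inv_dih\<close>)
  moreover have "c ` S \<subseteq> {False} \<times> {0..<int m}"
    using none c by (force simp: generating_tuples_def carrier_dih PiE_def Pi_iff)
  ultimately have "generate (dih m) (c ` S) \<subseteq> {False} \<times> {0..<int m}"
    by (rule H.generate_subgroup_incl[rotated])
  then have "carrier (dih m) \<subseteq> {False} \<times> {0..<int m}" using c by (simp add: generating_tuples_def)
  moreover have "(True, 0) \<in> carrier (dih m)" using m by (simp add: carrier_dih)
  ultimately show False by blast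
qed


section \<open>Counting tuples\<close>

lemma card_generating_tuples_integer_mod:
  assumes "finite I"
  shows "card (generating_tuples (integer_mod_group m) I) = jordan_totient (card I) m"
proof -
  obtain f where f: "bij_betw f I {..<card I}"
    using ex_bij_betw_finite_nat[OF assms] by (auto simp: atLeast0LessThan)
  define h where "h = inv_into I f"
  have h: "bij_betw h {..<card I} I" unfolding h_def by (rule bij_betw_inv_into[OF f])
  have hf: "h (f i) = i" if "i \<in> I" for i
    using that f by (simp add: h_def bij_betw_inv_into_left)
  have fh: "f (h j) = j" if "j < card I" for j
    using that f by (simp add: h_def bij_betw_inv_into_right)
  have mem: "f i < card I" if "i \<in> I" for i using f that by (auto dest: bij_betwE)
  have mem': "h j \<in> I" if "j < card I" for j using h that by (auto dest: bij_betwE)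
  have im: "(\<lambda>i. t (f i)) ` I = t ` {..<card I}" for t :: "nat \<Rightarrow> int"
  proof -
    have "(\<lambda>i. t (f i)) ` I = t ` f ` I" by (simp add: image_image)
    then show ?thesis using f by (simp add: bij_betw_def)
  qed
  have im': "(\<lambda>j. t (h j)) ` {..<card I} = t ` I" for t :: "'a \<Rightarrow> int"
  proof -
    have "(\<lambda>j. t (h j)) ` {..<card I} = t ` h ` {..<card I}" by (simp add: image_image)
    then show ?thesis using h by (simp add: bij_betw_def)
  qed
  have "bij_betw (\<lambda>t. \<lambda>j\<in>{..<card I}. t (h j)) (generating_tuples (integer_mod_group m) I)
      (generating_tuples (integer_mod_group m) {..<card I})"
    by (rule bij_betwI[where g = "\<lambda>t. \<lambda>i\<in>I. t (f i)"])
      (auto simp: generating_tuples_def im im' mem mem' hf fh PiE_def Pi_iff extensional_def fun_eq_iff)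
  then show ?thesis
    by (simp add: bij_betw_same_card jordan_totient_def generating_tuples_def)
qed

text \<open>
  The tuple whose entry at \<open>\<sigma>\<close> is the reflection \<open>s = (True, k)\<close> and whose entry at \<open>i \<in> I\<close> is
  \<open>s\<^sup>e y\<^sup>t\<close> with \<open>e = e i\<close> and \<open>t = t i\<close>.
\<close>

definition refl_tuple ::
    "nat \<Rightarrow> 'a \<Rightarrow> 'a set \<Rightarrow> int \<Rightarrow> ('a \<Rightarrow> bool) \<Rightarrow> ('a \<Rightarrow> int) \<Rightarrow> 'a \<Rightarrow> bool \<times> int" where
  "refl_tuple m \<sigma> I k e t =
     (\<lambda>x\<in>insert \<sigma> I. if x = \<sigma> then refl_coord m k True 0 else refl_coord m k (e x) (t x))"

text \<open>
  Every tuple with the reflection \<open>(True, k)\<close> at \<open>\<sigma>\<close> has unique coordinates \<open>(t, e)\<close>.  By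
  \<open>generate_dih_iff\<close> the condition of generating constrains \<open>t\<close> alone, which leaves the property \<open>P\<close>
  to select the bit patterns \<open>e\<close> over each \<open>t\<close>.
\<close>

lemma card_tuples_at_reflection:
  assumes m: "m > 0" and I: "finite I" "\<sigma> \<notin> I" and k: "k \<in> {0..<int m}"
    and N: "\<And>t. t \<in> generating_tuples (integer_mod_group m) I \<Longrightarrow>
      card {e \<in> I \<rightarrow>\<^sub>E UNIV. P (refl_tuple m \<sigma> I k e t)} = N"
  shows "card {c \<in> generating_tuples (dih m) (insert \<sigma> I). c \<sigma> = (True, k) \<and> P c} =
    jordan_totient (card I) m * N"
proof -
  let ?J = "generating_tuples (integer_mod_group m) I"
  let ?E = "\<lambda>t. {e \<in> I \<rightarrow>\<^sub>E UNIV. P (refl_tuple m \<sigma> I k e t)}"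
  have s: "refl_coord m k True 0 = (True, k)" using k by (simp add: refl_coord_def)
  have carZ: "carrier (integer_mod_group m) = {0..<int m}" using m by (simp add: carrier_integer_mod_group)
  have img: "refl_tuple m \<sigma> I k e t ` insert \<sigma> I =
      insert (refl_coord m k True 0) ((\<lambda>i. refl_coord m k (e i) (t i)) ` I)" for e t
    using I(2) by (auto simp: refl_tuple_def image_iff)
  have gen: "refl_tuple m \<sigma> I k e t \<in> generating_tuples (dih m) (insert \<sigma> I) \<longleftrightarrow> t \<in> ?J"
    if "t \<in> I \<rightarrow>\<^sub>E {0..<int m}" for e t
  proof -
    have "refl_tuple m \<sigma> I k e t \<in> insert \<sigma> I \<rightarrow>\<^sub>E carrier (dih m)"
      using m by (auto simp: refl_tuple_def)
    moreover have "t \<in> I \<rightarrow> {0..<int m}" using that by auto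
    ultimately show ?thesis
      using that generate_dih_iff[OF m, of t I k e]
      by (simp add: generating_tuples_def img carZ del: image_insert)
  qed
  have "bij_betw (\<lambda>(t, e). refl_tuple m \<sigma> I k e t) (SIGMA t:?J. ?E t)
      {c \<in> generating_tuples (dih m) (insert \<sigma> I). c \<sigma> = (True, k) \<and> P c}"
  proof (rule bij_betw_imageI)
    show "inj_on (\<lambda>(t, e). refl_tuple m \<sigma> I k e t) (SIGMA t:?J. ?E t)"
    proof (rule inj_onI, clarify)
      fix t e t' e'
      assume t: "t \<in> ?J" "t' \<in> ?J" and e: "e \<in> I \<rightarrow>\<^sub>E UNIV" "e' \<in> I \<rightarrow>\<^sub>E UNIV"
        and eq: "refl_tuple m \<sigma> I k e t = refl_tuple m \<sigma> I k e' t'"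
      have "t \<in> I \<rightarrow>\<^sub>E {0..<int m}" "t' \<in> I \<rightarrow>\<^sub>E {0..<int m}"
        using t by (auto simp: generating_tuples_def carZ)
      moreover have "e i = e' i \<and> t i = t' i" if i: "i \<in> I" for i
      proof -
        have "refl_coord m k (e i) (t i) = refl_coord m k (e' i) (t' i)"
          using fun_cong[OF eq, of i] i I(2) by (auto simp: refl_tuple_def split: if_splits)
        then have "e i = e' i" "t i mod int m = t' i mod int m" by (simp_all add: mod_eq_dvd_iff)
        moreover have "t i \<in> {0..<int m}" "t' i \<in> {0..<int m}"
          using i calculation t by (auto simp: generating_tuples_def carZ PiE_def Pi_iff)
        ultimately show ?thesis by simp
      qed
      ultimately show "t = t' \<and> e = e'" using e by (auto intro!: PiE_ext[of _ I])
    qed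
    show "(\<lambda>(t, e). refl_tuple m \<sigma> I k e t) ` (SIGMA t:?J. ?E t) =
        {c \<in> generating_tuples (dih m) (insert \<sigma> I). c \<sigma> = (True, k) \<and> P c}" (is "?L = ?R")
    proof
      have "refl_tuple m \<sigma> I k e t \<in> generating_tuples (dih m) (insert \<sigma> I)" if "t \<in> ?J" for e t
        using that gen[of t e] by (auto simp: generating_tuples_def carZ)
      then show "?L \<subseteq> ?R" by (auto simp: refl_tuple_def s)
      show "?R \<subseteq> ?L"
      proof
        fix c assume "c \<in> ?R"
        then have c: "c \<in> generating_tuples (dih m) (insert \<sigma> I)" "c \<sigma> = (True, k)" "P c" by auto
        have "\<exists>p. snd p \<in> {0..<int m} \<and> c i = refl_coord m k (fst p) (snd p)" if "i \<in> I" for i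
        proof -
          have "c i \<in> carrier (dih m)" using c(1) that by (auto simp: generating_tuples_def)
          then show ?thesis by (cases rule: refl_coord_cases[where k = k]) fastforce
        qed
        then obtain p where p: "\<And>i. i \<in> I \<Longrightarrow> snd (p i) \<in> {0..<int m} \<and> c i = refl_coord m k (fst (p i)) (snd (p i))"
          by metis
        define e where "e = (\<lambda>i\<in>I. fst (p i))"
        define t where "t = (\<lambda>i\<in>I. snd (p i))"
        have "c \<in> extensional (insert \<sigma> I)" using c(1) by (auto simp: generating_tuples_def PiE_def)
        then have eq: "refl_tuple m \<sigma> I k e t = c"
          using p c(2) by (auto simp: refl_tuple_def fun_eq_iff e_def t_def s extensional_def)
        have t: "t \<in> I \<rightarrow>\<^sub>E {0..<int m}" using p by (auto simp: t_def)
        have "e \<in> I \<rightarrow>\<^sub>E UNIV" by (auto simp: e_def)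
        moreover have "t \<in> ?J" using eq c(1) gen[OF t, of e] by simp
        ultimately have "(t, e) \<in> (SIGMA t:?J. ?E t)" using eq c(3) by simp
        moreover have "c = (\<lambda>(t, e). refl_tuple m \<sigma> I k e t) (t, e)" using eq by simp
        ultimately show "c \<in> ?L" by (rule image_eqI[rotated])
      qed
    qed
  qed
  then have "card {c \<in> generating_tuples (dih m) (insert \<sigma> I). c \<sigma> = (True, k) \<and> P c} = card (SIGMA t:?J. ?E t)"
    by (simp add: bij_betw_same_card)
  also have "\<dots> = (\<Sum>t\<in>?J. card (?E t))"
  proof (rule card_SigmaI)
    have "finite (I \<rightarrow>\<^sub>E {0..<int m})" using I by (intro finite_PiE) auto
    then show "finite ?J" by (rule finite_subset[rotated]) (auto simp: generating_tuples_def carZ)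
    have "finite (I \<rightarrow>\<^sub>E (UNIV :: bool set))" using I by (intro finite_PiE) auto
    then show "\<forall>t\<in>?J. finite (?E t)" by simp
  qed
  also have "\<dots> = jordan_totient (card I) m * N"
    using N by (simp add: card_generating_tuples_integer_mod[OF I(1)])
  finally show ?thesis .
qed

lemma finite_generating_tuples: "finite (carrier G) \<Longrightarrow> finite S \<Longrightarrow> finite (generating_tuples G S)"
  by (rule finite_subset[of _ "S \<rightarrow>\<^sub>E carrier G"]) (auto simp: generating_tuples_def intro: finite_PiE)

lemma card_tuples_reflection:
  assumes m: "m > 0" and I: "finite I" "\<sigma> \<notin> I"
    and at_refl: "\<And>c. c \<in> generating_tuples (dih m) (insert \<sigma> I) \<Longrightarrow> P c \<Longrightarrow> fst (c \<sigma>)"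
    and N: "\<And>t k. t \<in> generating_tuples (integer_mod_group m) I \<Longrightarrow>
      card {e \<in> I \<rightarrow>\<^sub>E UNIV. P (refl_tuple m \<sigma> I k e t)} = N"
  shows "card {c \<in> generating_tuples (dih m) (insert \<sigma> I). P c} = m * jordan_totient (card I) m * N"
proof -
  let ?T = "\<lambda>k. {c \<in> generating_tuples (dih m) (insert \<sigma> I). c \<sigma> = (True, k) \<and> P c}"
  have fin: "finite (generating_tuples (dih m) (insert \<sigma> I))"
    using I by (intro finite_generating_tuples) (auto simp: carrier_dih)
  have "{c \<in> generating_tuples (dih m) (insert \<sigma> I). P c} = (\<Union>k\<in>{0..<int m}. ?T k)"
  proof -
    have "\<exists>k\<in>{0..<int m}. c \<sigma> = (True, k)" if "c \<in> generating_tuples (dih m) (insert \<sigma> I)" "P c" for c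
    proof -
      have "c \<sigma> \<in> carrier (dih m)" using that(1) by (auto simp: generating_tuples_def)
      then show ?thesis using at_refl[OF that] by (cases "c \<sigma>") (simp add: carrier_dih)
    qed
    then show ?thesis by auto
  qed
  moreover have "card (\<Union>k\<in>{0..<int m}. ?T k) = (\<Sum>k\<in>{0..<int m}. card (?T k))"
    by (rule card_UN_disjoint) (use fin in auto)
  ultimately have "card {c \<in> generating_tuples (dih m) (insert \<sigma> I). P c} = (\<Sum>k\<in>{0..<int m}. card (?T k))"
    by (simp only:)
  also have "\<dots> = (\<Sum>k\<in>{0..<int m}. jordan_totient (card I) m * N)"
    by (intro sum.cong refl card_tuples_at_reflection[OF m I]) (auto intro: N)
  finally show ?thesis by simp
qed

text \<open>The two reflections contribute equally by \<open>card_tuples_at_reflection\<close>, and the automorphism of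
  the Klein four-group that exchanges \<open>x\<close> and \<open>y\<close> carries the tuples with \<open>x\<close> at \<open>\<sigma>\<close> to those with
  the rotation \<open>y\<close> there.\<close>

lemma card_tuples_klein:
  assumes I: "finite I" "\<sigma> \<notin> I"
  shows "card {c \<in> generating_tuples (dih 2) (insert \<sigma> I). c \<sigma> \<noteq> \<one>\<^bsub>dih 2\<^esub>} =
    3 * jordan_totient (card I) 2 * 2 ^ card I"
proof -
  let ?S = "insert \<sigma> I"
  let ?T = "\<lambda>p. {c \<in> generating_tuples (dih 2) ?S. c \<sigma> = p}"
  interpret H: group "dih 2" by (rule group_dih) simp
  have fin: "finite (generating_tuples (dih 2) ?S)"
    using I by (intro finite_generating_tuples) (auto simp: carrier_dih)
  have N: "card {e \<in> I \<rightarrow>\<^sub>E (UNIV :: bool set). True} = 2 ^ card I"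
    using I by (simp add: card_PiE)
  have at_refl: "card (?T (True, k)) = jordan_totient (card I) 2 * 2 ^ card I" if "k \<in> {0..<2}" for k
    using card_tuples_at_reflection[of 2 I \<sigma> k "\<lambda>_. True" "2 ^ card I"] I that N by simp
  define \<tau> :: "bool \<times> int \<Rightarrow> bool \<times> int" where "\<tau> = (\<lambda>(e, j). (j = 1, if e then 1 else 0))"
  have \<tau>: "\<tau> \<in> hom (dih 2) (dih 2)"
  proof (rule homI)
    fix p q assume "p \<in> carrier (dih 2)" "q \<in> carrier (dih 2)"
    moreover obtain e j f k where "p = (e, j)" "q = (f, k)" by fastforce
    moreover from calculation have "j = 0 \<or> j = 1" "k = 0 \<or> k = 1"
      by (auto simp: carrier_dih)
    ultimately show "\<tau> (p \<otimes>\<^bsub>dih 2\<^esub> q) = \<tau> p \<otimes>\<^bsub>dih 2\<^esub> \<tau> q"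
      by (elim disjE; cases e; cases f) (simp_all add: \<tau>_def)
  qed (auto simp: \<tau>_def carrier_dih)
  have \<tau>\<tau>: "\<tau> (\<tau> p) = p" if "p \<in> carrier (dih 2)" for p
  proof -
    obtain e j where "p = (e, j)" by fastforce
    moreover from this have "j = 0 \<or> j = 1" using that by (auto simp: carrier_dih)
    ultimately show ?thesis by (auto simp: \<tau>_def)
  qed
  interpret \<tau>: group_hom "dih 2" "dih 2" \<tau> by unfold_locales (rule \<tau>)
  have gen: "(\<lambda>x\<in>?S. \<tau> (c x)) \<in> generating_tuples (dih 2) ?S" if c: "c \<in> generating_tuples (dih 2) ?S" for c
  proof -
    have sub: "c ` ?S \<subseteq> carrier (dih 2)" using c by (auto simp: generating_tuples_def)
    have "(\<lambda>x\<in>?S. \<tau> (c x)) ` ?S = \<tau> ` (c ` ?S)" by (auto simp: image_iff)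
    then have "generate (dih 2) ((\<lambda>x\<in>?S. \<tau> (c x)) ` ?S) = \<tau> ` generate (dih 2) (c ` ?S)"
      using \<tau>.generate_img[OF sub] by simp
    also have "\<dots> = \<tau> ` carrier (dih 2)" using c by (simp add: generating_tuples_def)
    also have "\<dots> = carrier (dih 2)"
    proof
      show "\<tau> ` carrier (dih 2) \<subseteq> carrier (dih 2)" using \<tau>.hom_closed by blast
      show "carrier (dih 2) \<subseteq> \<tau> ` carrier (dih 2)"
      proof
        fix p assume "p \<in> carrier (dih 2)"
        then show "p \<in> \<tau> ` carrier (dih 2)" using \<tau>\<tau>[of p] \<tau>.hom_closed[of p] by (metis imageI)
      qed
    qed
    finally show ?thesis using sub by (auto simp: generating_tuples_def)
  qed
  have "bij_betw (\<lambda>c. \<lambda>x\<in>?S. \<tau> (c x)) (?T (True, 0)) (?T (False, 1))"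
  proof (rule bij_betwI[where g = "\<lambda>c. \<lambda>x\<in>?S. \<tau> (c x)"])
    have inv: "(\<lambda>x\<in>?S. \<tau> ((\<lambda>x\<in>?S. \<tau> (c x)) x)) = c" if "c \<in> generating_tuples (dih 2) ?S" for c
    proof
      fix x
      have "x \<in> ?S \<Longrightarrow> c x \<in> carrier (dih 2)" "x \<notin> ?S \<Longrightarrow> c x = undefined"
        using that by (auto simp: generating_tuples_def)
      then show "(\<lambda>x\<in>?S. \<tau> ((\<lambda>x\<in>?S. \<tau> (c x)) x)) x = c x"
        by (cases "x \<in> ?S") (simp_all add: \<tau>\<tau>)
    qed
    then show "(\<lambda>x\<in>?S. \<tau> ((\<lambda>x\<in>?S. \<tau> (c x)) x)) = c" if "c \<in> ?T (True, 0)" for c using that by blast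
    show "(\<lambda>x\<in>?S. \<tau> ((\<lambda>x\<in>?S. \<tau> (c x)) x)) = c" if "c \<in> ?T (False, 1)" for c using inv that by blast
  qed (use gen in \<open>auto simp: \<tau>_def\<close>)
  from bij_betw_same_card[OF this] have rot: "card (?T (False, 1)) = jordan_totient (card I) 2 * 2 ^ card I"
    using at_refl[of 0] by simp
  have "c \<sigma> \<in> {(True, 0), (True, 1), (False, 1)}"
    if "c \<in> generating_tuples (dih 2) ?S" "c \<sigma> \<noteq> \<one>\<^bsub>dih 2\<^esub>" for c
  proof -
    have "c \<sigma> \<in> carrier (dih 2)" using that(1) by (auto simp: generating_tuples_def)
    moreover obtain e j where e: "c \<sigma> = (e, j)" by fastforce
    ultimately have "j = 0 \<or> j = 1" by (auto simp: carrier_dih)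
    then show ?thesis using that(2) e by (cases e) auto
  qed
  then have "{c \<in> generating_tuples (dih 2) ?S. c \<sigma> \<noteq> \<one>\<^bsub>dih 2\<^esub>} =
      ?T (True, 0) \<union> ?T (True, 1) \<union> ?T (False, 1)" by auto
  also have "card \<dots> = card (?T (True, 0)) + card (?T (True, 1)) + card (?T (False, 1))"
  proof -
    have "finite (?T p)" for p using fin by simp
    then show ?thesis by (simp add: card_Un_disjoint disjoint_iff)
  qed
  finally show ?thesis using at_refl[of 0] at_refl[of 1] rot by simp
qed


section \<open>The relations of the surface braid group\<close>

text \<open>
  The generators \<open>a\<^sub>i\<close> and \<open>b\<^sub>i\<close> belong to the \<open>i\<close>-th handle of the surface.
\<close>

definition handle_gens :: "nat \<Rightarrow> braid_gen set" where
  "handle_gens g = Gen_a ` {1..g} \<union> Gen_b ` {1..g}"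

primrec handle :: "braid_gen \<Rightarrow> nat" where
  "handle (Gen_a i) = i"
| "handle (Gen_b i) = i"
| "handle Gen_sigma = 0"

lemma braid_gens_eq: "braid_gens g = insert Gen_sigma (handle_gens g)"
  by (auto simp: braid_gens_def handle_gens_def)

lemma handle_gens_simps [simp]:
  "Gen_a i \<in> handle_gens g \<longleftrightarrow> i \<in> {1..g}"
  "Gen_b i \<in> handle_gens g \<longleftrightarrow> i \<in> {1..g}"
  "Gen_sigma \<notin> handle_gens g"
  by (auto simp: handle_gens_def)

lemma finite_handle_gens [simp]: "finite (handle_gens g)"
  by (simp add: handle_gens_def)

lemma card_handle_gens: "card (handle_gens g) = 2 * g"
proof -
  have "Gen_a ` {1..g} \<inter> Gen_b ` {1..g} = {}" by auto
  then show ?thesis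
    by (simp add: handle_gens_def card_Un_disjoint card_image inj_on_def)
qed

lemma (in group) commutator_eq_iff:
  assumes "u \<in> carrier G" "v \<in> carrier G" "w \<in> carrier G"
  shows "u \<otimes> (v \<otimes> (inv u \<otimes> inv v)) = w \<longleftrightarrow> u \<otimes> v = w \<otimes> (v \<otimes> u)"
proof -
  have "u \<otimes> (v \<otimes> (inv u \<otimes> inv v)) = (u \<otimes> v) \<otimes> inv (v \<otimes> u)"
    using assms by (simp add: inv_mult_group m_assoc)
  then show ?thesis
    using assms inv_solve_right'[of w "u \<otimes> v" "v \<otimes> u"] by auto
qed

lemma ball_setcompr:
  "(\<forall>x\<in>{f i |i. P i}. Q x) \<longleftrightarrow> (\<forall>i. P i \<longrightarrow> Q (f i))"
  by blast

lemma ball_setcompr2: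
  "(\<forall>x\<in>{f i j |i j. P i j}. Q x) \<longleftrightarrow> (\<forall>i j. P i j \<longrightarrow> Q (f i j))"
  by blast

text \<open>
  All relations but the product relation, with a commutator equation \<open>[u, v] = w\<close> rewritten as
  \<open>u v = w v u\<close>.  The two families \<open>[a\<^sub>i, \<sigma>\<^sup>-\<^sup>1 a\<^sub>i \<sigma>\<^sup>-\<^sup>1]\<close> and \<open>[b\<^sub>i, \<sigma>\<^sup>-\<^sup>1 b\<^sub>i \<sigma>\<^sup>-\<^sup>1]\<close>, and likewise the four
  families between different handles, have the same shape and are merged by letting \<open>p\<close> and \<open>q\<close> range
  over both kinds of handle generators.
\<close>

definition handle_relations :: "('b, 'c) monoid_scheme \<Rightarrow> nat \<Rightarrow> (braid_gen \<Rightarrow> 'b) \<Rightarrow> bool" where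
  "handle_relations G g c \<longleftrightarrow>
    (let s = c Gen_sigma; s' = inv\<^bsub>G\<^esub> s;
         A = (\<lambda>p q. c p \<otimes>\<^bsub>G\<^esub> (s' \<otimes>\<^bsub>G\<^esub> (c q \<otimes>\<^bsub>G\<^esub> s')) = (s' \<otimes>\<^bsub>G\<^esub> (c q \<otimes>\<^bsub>G\<^esub> s')) \<otimes>\<^bsub>G\<^esub> c p);
         B = (\<lambda>p q. c p \<otimes>\<^bsub>G\<^esub> (s' \<otimes>\<^bsub>G\<^esub> (c q \<otimes>\<^bsub>G\<^esub> s)) = (s' \<otimes>\<^bsub>G\<^esub> (c q \<otimes>\<^bsub>G\<^esub> s)) \<otimes>\<^bsub>G\<^esub> c p)
     in (\<forall>p\<in>handle_gens g. A p p)
      \<and> (\<forall>p\<in>handle_gens g. \<forall>q\<in>handle_gens g. handle q < handle p \<longrightarrow> B p q)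
      \<and> (\<forall>i\<in>{1..g}. c (Gen_a i) \<otimes>\<^bsub>G\<^esub> (s' \<otimes>\<^bsub>G\<^esub> (c (Gen_b i) \<otimes>\<^bsub>G\<^esub> s')) =
            s \<otimes>\<^bsub>G\<^esub> s \<otimes>\<^bsub>G\<^esub> ((s' \<otimes>\<^bsub>G\<^esub> (c (Gen_b i) \<otimes>\<^bsub>G\<^esub> s')) \<otimes>\<^bsub>G\<^esub> c (Gen_a i))))"

context group
begin

lemma word_val_wcomm:
  assumes "c \<in> S \<rightarrow> carrier G" "u \<in> words S" "v \<in> words S"
  shows "word_val G c (wcomm u v) =
    word_val G c u \<otimes> (word_val G c v \<otimes> (inv word_val G c u \<otimes> inv word_val G c v))"
  using assms by (simp add: wcomm_def word_val_append[of c S] word_val_winv[of c S])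

lemma satisfies_braid_rels_iff:
  assumes c: "c \<in> braid_gens g \<rightarrow> carrier G"
  shows "satisfies G (braid_gens g) (braid_rels g) c \<longleftrightarrow> handle_relations G g c \<and>
    word_val G c (concat (map (\<lambda>i. wcomm (letter (Gen_a i)) (winv (letter (Gen_b i)))) [1..<Suc g])) =
      c Gen_sigma \<otimes> c Gen_sigma"
proof -
  let ?S = "braid_gens g"
  have W: "Gen_sigma \<in> ?S" "\<And>i. Gen_a i \<in> ?S \<longleftrightarrow> i \<in> {1..g}" "\<And>i. Gen_b i \<in> ?S \<longleftrightarrow> i \<in> {1..g}"
    by (auto simp: braid_gens_def)
  have car: "c Gen_sigma \<in> carrier G" "\<And>i. i \<in> {1..g} \<Longrightarrow> c (Gen_a i) \<in> carrier G"
    "\<And>i. i \<in> {1..g} \<Longrightarrow> c (Gen_b i) \<in> carrier G"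
    using c W by (auto simp: Pi_iff)
  let ?E = "word_val G c" and ?s' = "winv (letter Gen_sigma)" and ?s = "letter Gen_sigma"
  define K where "K = concat (map (\<lambda>i. wcomm (letter (Gen_a i)) (winv (letter (Gen_b i)))) [1..<Suc g])"
  have sat: "satisfies G ?S (braid_rels g) c \<longleftrightarrow> (\<forall>(u, v)\<in>braid_rels g. ?E u = ?E v)"
    using braid_rels_words[of g] by (auto simp: satisfies_def)
  \<comment> \<open>Each relation becomes an opaque predicate on its generators, so that the matching of the index
    ranges is pure logic and word values are computed one relation at a time.\<close>
  define A where "A p q \<longleftrightarrow> ?E (wcomm (letter p) (?s' @ letter q @ ?s')) = ?E []" for p q
  define B where "B p q \<longleftrightarrow> ?E (wcomm (letter p) (?s' @ letter q @ ?s)) = ?E []" for p q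
  define D where "D i \<longleftrightarrow> ?E (wcomm (letter (Gen_a i)) (?s' @ letter (Gen_b i) @ ?s')) = ?E (?s @ ?s)" for i
  have rels: "(\<forall>(u, v)\<in>braid_rels g. ?E u = ?E v) \<longleftrightarrow>
      (\<forall>i\<in>{1..g}. A (Gen_a i) (Gen_a i) \<and> A (Gen_b i) (Gen_b i) \<and> D i) \<and>
      (\<forall>i\<in>{1..g}. \<forall>j\<in>{1..g}. j < i \<longrightarrow> B (Gen_a i) (Gen_a j) \<and> B (Gen_a i) (Gen_b j) \<and>
        B (Gen_b i) (Gen_a j) \<and> B (Gen_b i) (Gen_b j)) \<and> ?E K = ?E (?s @ ?s)"
    unfolding braid_rels_def Let_def ball_Un ball_setcompr ball_setcompr2 prod.case
      K_def[symmetric] A_def[symmetric] B_def[symmetric] D_def[symmetric]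
    by auto
  note ev = word_val_wcomm[OF c] word_val_append[OF c] word_val_winv[OF c] word_val_letter
  have cI: "c p \<in> carrier G" "p \<in> ?S" if "p \<in> handle_gens g" for p
    using that c by (auto simp: braid_gens_eq)
  have A: "A p q \<longleftrightarrow> c p \<otimes> (inv c Gen_sigma \<otimes> (c q \<otimes> inv c Gen_sigma)) =
      (inv c Gen_sigma \<otimes> (c q \<otimes> inv c Gen_sigma)) \<otimes> c p"
    and B: "B p q \<longleftrightarrow> c p \<otimes> (inv c Gen_sigma \<otimes> (c q \<otimes> c Gen_sigma)) =
      (inv c Gen_sigma \<otimes> (c q \<otimes> c Gen_sigma)) \<otimes> c p"
    if "p \<in> handle_gens g" "q \<in> handle_gens g" for p q
    unfolding A_def B_def using that cI[of p] cI[of q] car(1) W(1)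
    by (simp_all add: ev commutator_eq_iff)
  have D: "D i \<longleftrightarrow> c (Gen_a i) \<otimes> (inv c Gen_sigma \<otimes> (c (Gen_b i) \<otimes> inv c Gen_sigma)) =
      c Gen_sigma \<otimes> c Gen_sigma \<otimes>
        ((inv c Gen_sigma \<otimes> (c (Gen_b i) \<otimes> inv c Gen_sigma)) \<otimes> c (Gen_a i))"
    if "i \<in> {1..g}" for i
    unfolding D_def using that car W by (simp add: ev commutator_eq_iff)
  have all: "(\<forall>p\<in>handle_gens g. Q p) \<longleftrightarrow> (\<forall>i\<in>{1..g}. Q (Gen_a i) \<and> Q (Gen_b i))" for Q
    unfolding handle_gens_def by blast
  have "handle_relations G g c \<longleftrightarrow> (\<forall>p\<in>handle_gens g. A p p) \<and>
      (\<forall>p\<in>handle_gens g. \<forall>q\<in>handle_gens g. handle q < handle p \<longrightarrow> B p q) \<and> (\<forall>i\<in>{1..g}. D i)"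
    unfolding handle_relations_def Let_def
    by (intro conj_cong ball_cong imp_cong refl) (simp_all add: A B D)
  also have "\<dots> \<longleftrightarrow> (\<forall>i\<in>{1..g}. A (Gen_a i) (Gen_a i) \<and> A (Gen_b i) (Gen_b i) \<and> D i) \<and>
      (\<forall>i\<in>{1..g}. \<forall>j\<in>{1..g}. j < i \<longrightarrow> B (Gen_a i) (Gen_a j) \<and> B (Gen_a i) (Gen_b j) \<and>
        B (Gen_b i) (Gen_a j) \<and> B (Gen_b i) (Gen_b j))"
    unfolding all handle.simps by blast
  finally show ?thesis
    unfolding sat rels K_def[symmetric] using car(1) W(1) by (simp add: ev)
qed

lemma word_val_concat_one:
  assumes c: "c \<in> S \<rightarrow> carrier G" and "\<And>w. w \<in> set ws \<Longrightarrow> w \<in> words S \<and> word_val G c w = \<one>"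
  shows "word_val G c (concat ws) = \<one>"
proof -
  have "concat ws \<in> words S \<and> word_val G c (concat ws) = \<one>"
    using assms(2) by (induction ws) (auto simp: word_val_append[OF c])
  then show ?thesis ..
qed

text \<open>
  The product relation holds when \<open>\<sigma>\<close> is sent to an involution and each commutator in the product is
  trivial.
\<close>

lemma satisfies_braid_relsI:
  assumes c: "c \<in> braid_gens g \<rightarrow> carrier G" and "handle_relations G g c"
    and "c Gen_sigma \<otimes> c Gen_sigma = \<one>"
    and comm: "\<And>i. i \<in> {1..g} \<Longrightarrow>
      c (Gen_a i) \<otimes> inv c (Gen_b i) = inv c (Gen_b i) \<otimes> c (Gen_a i)"
  shows "satisfies G (braid_gens g) (braid_rels g) c"
proof -
  have "word_val G c (wcomm (letter (Gen_a i)) (winv (letter (Gen_b i)))) = \<one>" if "i \<in> {1..g}" for i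
  proof -
    have W: "Gen_a i \<in> braid_gens g" "Gen_b i \<in> braid_gens g" using that by (auto simp: braid_gens_def)
    then have car: "c (Gen_a i) \<in> carrier G" "c (Gen_b i) \<in> carrier G" using c by (auto simp: Pi_iff)
    then show ?thesis
      using comm[OF that] W commutator_eq_iff[of "c (Gen_a i)" "inv c (Gen_b i)" \<one>]
      by (simp add: word_val_wcomm[OF c] word_val_winv[OF c] word_val_letter)
  qed
  moreover have "wcomm (letter (Gen_a i)) (winv (letter (Gen_b i))) \<in> words (braid_gens g)"
    if "i \<in> {1..g}" for i
    using that by (auto simp: braid_gens_def)
  ultimately have "word_val G c
      (concat (map (\<lambda>i. wcomm (letter (Gen_a i)) (winv (letter (Gen_b i)))) [1..<Suc g])) = \<one>"
    by (intro word_val_concat_one[OF c]) auto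
  then show ?thesis using assms by (simp add: satisfies_braid_rels_iff[OF c])
qed

end

subsection \<open>Tuples with a reflection at \<open>\<sigma>\<close>\<close>

text \<open>
  Conjugation by the reflection \<open>s\<close> negates exponents and \<open>s\<^sup>2 = 1\<close>, so every relation says that
  \<open>s\<^sup>e y\<^sup>t\<close> and \<open>s\<^sup>f y\<^sup>-\<^sup>u\<close> commute.  The resulting congruence is symmetric in \<open>p\<close> and \<open>q\<close>, hence
  holds for all pairs once it holds for the ordered ones listed here.
\<close>

lemma handle_relations_refl_tuple:
  assumes m: "m > 0"
  shows "handle_relations (dih m) g (refl_tuple m Gen_sigma (handle_gens g) k e t) \<longleftrightarrow>
    (\<forall>p\<in>handle_gens g. \<forall>q\<in>handle_gens g. p = q \<or> handle q < handle p \<or> (\<exists>i. p = Gen_a i \<and> q = Gen_b i) \<longrightarrow>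
      int m dvd 2 * ((if e q then t p else 0) + (if e p then t q else 0)))"
    (is "_ \<longleftrightarrow> ?R")
proof -
  let ?c = "refl_tuple m Gen_sigma (handle_gens g) k e t"
  have s: "?c Gen_sigma = refl_coord m k True 0" by (simp add: refl_tuple_def)
  have c: "?c p = refl_coord m k (e p) (t p)" if "p \<in> handle_gens g" for p
    using that by (auto simp: refl_tuple_def)
  have ss: "refl_coord m k True 0 \<otimes>\<^bsub>dih m\<^esub> refl_coord m k True 0 = refl_coord m k False 0" by simp
  have conj: "refl_coord m k True 0 \<otimes>\<^bsub>dih m\<^esub> (refl_coord m k f u \<otimes>\<^bsub>dih m\<^esub> refl_coord m k True 0) =
      refl_coord m k f (- u)" for f u
    by (cases f) simp_all
  have comm: "refl_coord m k e t \<otimes>\<^bsub>dih m\<^esub> refl_coord m k f (- u) = refl_coord m k f (- u) \<otimes>\<^bsub>dih m\<^esub> refl_coord m k e t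
    \<longleftrightarrow> int m dvd 2 * ((if f then t else 0) + (if e then u else 0))" for e f t u
    using refl_coord_commute_iff[OF m, of k e t f "- u"] by (cases e; cases f) simp_all
  have one: "refl_coord m k False 0 \<otimes>\<^bsub>dih m\<^esub> (refl_coord m k f v \<otimes>\<^bsub>dih m\<^esub> refl_coord m k f' v') =
      refl_coord m k f v \<otimes>\<^bsub>dih m\<^esub> refl_coord m k f' v'" for f v f' v'
    by simp
  have inv: "inv\<^bsub>dih m\<^esub> refl_coord m k True 0 = refl_coord m k True 0"
    using m by simp
  define d where "d p q \<longleftrightarrow> int m dvd 2 * ((if e q then t p else 0) + (if e p then t q else 0))" for p q
  have "handle_relations (dih m) g ?c \<longleftrightarrow> (\<forall>p\<in>handle_gens g. d p p) \<and>
      (\<forall>p\<in>handle_gens g. \<forall>q\<in>handle_gens g. handle q < handle p \<longrightarrow> d p q) \<and>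
      (\<forall>i\<in>{1..g}. d (Gen_a i) (Gen_b i))"
    unfolding handle_relations_def Let_def s inv ss
    by (intro conj_cong ball_cong imp_cong refl)
      (simp_all add: c conj comm one d_def del: refl_coord_mult refl_coord_eq_iff)
  then show ?thesis unfolding d_def[symmetric] by auto
qed

text \<open>If some bit is on, at \<open>p\<close> say, the pair \<open>(p, p)\<close> gives \<open>4 t p = 0\<close> and the pairs \<open>(p, q)\<close> extend
  this to all exponents; as these generate, \<open>m\<close> divides 4.  Modulo 4 the congruences say that the
  exponents with bit off are even and that the exponents with bit on have a common parity.
  That parity is odd, since even exponents do not generate.\<close>

lemma handle_relations_generating_iff:
  assumes m: "m \<ge> 3" and t: "t \<in> generating_tuples (integer_mod_group m) (handle_gens g)"
  shows "handle_relations (dih m) g (refl_tuple m Gen_sigma (handle_gens g) k e t) \<longleftrightarrow>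
    (\<forall>p\<in>handle_gens g. \<not> e p) \<or> m = 4 \<and> (\<forall>p\<in>handle_gens g. e p = odd (t p))"
    (is "?L \<longleftrightarrow> _")
proof
  have m0: "m > 0" using m by simp
  let ?d = "\<lambda>p q. int m dvd 2 * ((if e q then t p else 0) + (if e p then t q else 0))"
  note iff = handle_relations_refl_tuple[OF m0, of g k e t]
  {
    assume ?L
    then have rel: "?d p q" if "p \<in> handle_gens g" "q \<in> handle_gens g"
        "p = q \<or> handle q < handle p \<or> (\<exists>i. p = Gen_a i \<and> q = Gen_b i)" for p q
      using that iff by blast
    have all: "?d p q" if pq: "p \<in> handle_gens g" "q \<in> handle_gens g" for p q
    proof -
      have "(p = q \<or> handle q < handle p \<or> (\<exists>i. p = Gen_a i \<and> q = Gen_b i)) \<or>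
          (handle p < handle q \<or> (\<exists>i. q = Gen_a i \<and> p = Gen_b i))"
        using pq by (cases p; cases q) auto
      then show ?thesis using rel[of p q] rel[of q p] pq by (auto simp: add.commute)
    qed
    show "(\<forall>p\<in>handle_gens g. \<not> e p) \<or> m = 4 \<and> (\<forall>p\<in>handle_gens g. e p = odd (t p))"
    proof (cases "\<forall>p\<in>handle_gens g. \<not> e p")
      case False
      then obtain p where p: "p \<in> handle_gens g" "e p" by blast
      have p4: "int m dvd 4 * t p" using all[OF p(1) p(1)] p(2) by simp
      have q4: "int m dvd 4 * t q" if q: "q \<in> handle_gens g" for q
      proof (cases "e q")
        case True
        then have "int m dvd 2 * (2 * (t p + t q))" using all[OF p(1) q] p(2) by (metis dvd_mult)
        then have "int m dvd (2 * (2 * (t p + t q))) - 4 * t p" using p4 by (rule dvd_diff)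
        then show ?thesis by simp
      next
        case False
        then have "int m dvd 2 * (2 * t q)" using all[OF p(1) q] p(2) by (metis add_0 dvd_mult)
        then show ?thesis by simp
      qed
      have "int m dvd 4" using generating_integer_mod_annihilator[OF m0 t q4] .
      then have "m dvd 4" by presburger
      moreover from this have "m = 3 \<or> m = 4" using m dvd_imp_le[of m 4] by auto
      ultimately have m4: "m = 4" by auto
      have rot: "even (t q)" if "q \<in> handle_gens g" "\<not> e q" for q
        using all[OF p(1) that(1)] p(2) that(2) m4 by simp presburger
      have same: "even (t p + t q)" if "q \<in> handle_gens g" "e q" for q
        using all[OF p(1) that(1)] p(2) that(2) m4 by simp presburger
      \<comment> \<open>Otherwise all exponents would be even and could not generate.\<close>
      have "odd (t p)"
      proof
        assume "even (t p)"
        then have "int m dvd 2 * t q" if "q \<in> handle_gens g" for q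
          using rot[OF that] same[OF that] m4 by (cases "e q") (auto elim!: evenE)
        then have "int m dvd 2" using generating_integer_mod_annihilator[OF m0 t] by blast
        then show False using m4 by simp
      qed
      then have "e q = odd (t q)" if "q \<in> handle_gens g" for q
        using rot[OF that] same[OF that] by auto
      then show ?thesis using m4 by blast
    qed blast
  next
    assume "(\<forall>p\<in>handle_gens g. \<not> e p) \<or> m = 4 \<and> (\<forall>p\<in>handle_gens g. e p = odd (t p))"
    then show ?L
    proof
      assume "\<forall>p\<in>handle_gens g. \<not> e p"
      then show ?L unfolding iff by simp
    next
      assume *: "m = 4 \<and> (\<forall>p\<in>handle_gens g. e p = odd (t p))"
      have "?d p q" if "p \<in> handle_gens g" "q \<in> handle_gens g" for p q
        using * that by (cases "odd (t p)"; cases "odd (t q)") (simp_all, presburger+)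
      then show ?L unfolding iff by blast
    qed
  }
qed

lemma satisfies_braid_refl_tuple_iff:
  assumes m: "m \<ge> 3" and t: "t \<in> generating_tuples (integer_mod_group m) (handle_gens g)"
  shows "satisfies (dih m) (braid_gens g) (braid_rels g) (refl_tuple m Gen_sigma (handle_gens g) k e t) \<longleftrightarrow>
    (\<forall>p\<in>handle_gens g. \<not> e p) \<or> m = 4 \<and> (\<forall>p\<in>handle_gens g. e p = odd (t p))"
    (is "?L \<longleftrightarrow> ?R")
proof -
  let ?c = "refl_tuple m Gen_sigma (handle_gens g) k e t"
  have m0: "m > 0" using m by simp
  interpret H: group "dih m" by (rule group_dih[OF m0])
  have c: "?c \<in> braid_gens g \<rightarrow> carrier (dih m)"
    using m0 by (auto simp: refl_tuple_def braid_gens_eq)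
  have "?L \<Longrightarrow> ?R"
    using H.satisfies_braid_rels_iff[OF c] handle_relations_generating_iff[OF m t, of k e] by (simp only:)
  moreover have ?L if r: ?R
  proof (rule H.satisfies_braid_relsI[OF c])
    show "handle_relations (dih m) g ?c" using r handle_relations_generating_iff[OF m t, of k e] by (simp only:)
    show "?c Gen_sigma \<otimes>\<^bsub>dih m\<^esub> ?c Gen_sigma = \<one>\<^bsub>dih m\<^esub>"
      by (simp add: refl_tuple_def one_refl_coord[of m k] del: one_dih)
    fix i assume i: "i \<in> {1..g}"
    then have ab: "Gen_a i \<in> handle_gens g" "Gen_b i \<in> handle_gens g" by auto
    have ea: "?c (Gen_a i) = refl_coord m k (e (Gen_a i)) (t (Gen_a i))"
      and eb: "inv\<^bsub>dih m\<^esub> ?c (Gen_b i) =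
        refl_coord m k (e (Gen_b i)) (if e (Gen_b i) then t (Gen_b i) else - t (Gen_b i))"
      using ab m0 by (auto simp: refl_tuple_def)
    show "?c (Gen_a i) \<otimes>\<^bsub>dih m\<^esub> inv\<^bsub>dih m\<^esub> ?c (Gen_b i) = inv\<^bsub>dih m\<^esub> ?c (Gen_b i) \<otimes>\<^bsub>dih m\<^esub> ?c (Gen_a i)"
      unfolding ea eb refl_coord_commute_iff[OF m0] using r
    proof
      assume "m = 4 \<and> (\<forall>p\<in>handle_gens g. e p = odd (t p))"
      then have "m = 4" "e (Gen_a i) = odd (t (Gen_a i))" "e (Gen_b i) = odd (t (Gen_b i))" using ab by auto
      then show "int m dvd 2 * ((if e (Gen_b i) then t (Gen_a i) else 0) -
          (if e (Gen_a i) then if e (Gen_b i) then t (Gen_b i) else - t (Gen_b i) else 0))"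
        by (cases "odd (t (Gen_a i))"; cases "odd (t (Gen_b i))") (simp_all, presburger+)
    qed (use ab in simp)
  qed
  ultimately show ?thesis by blast
qed

lemma card_braid_refl_patterns:
  assumes m: "m \<ge> 3" and t: "t \<in> generating_tuples (integer_mod_group m) (handle_gens g)"
  shows "card {e \<in> handle_gens g \<rightarrow>\<^sub>E UNIV. satisfies (dih m) (braid_gens g) (braid_rels g)
      (refl_tuple m Gen_sigma (handle_gens g) k e t)} = (if m = 4 then 2 else 1)"
proof -
  let ?I = "handle_gens g"
  let ?F = "\<lambda>p\<in>?I. False" and ?O = "\<lambda>p\<in>?I. odd (t p)"
  have "{e \<in> ?I \<rightarrow>\<^sub>E UNIV. satisfies (dih m) (braid_gens g) (braid_rels g)
      (refl_tuple m Gen_sigma ?I k e t)} = (if m = 4 then {?F, ?O} else {?F})"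
  proof -
    have F: "(\<forall>p\<in>?I. \<not> e p) \<longleftrightarrow> e = ?F" and O: "(\<forall>p\<in>?I. e p = odd (t p)) \<longleftrightarrow> e = ?O"
      if "e \<in> ?I \<rightarrow>\<^sub>E UNIV" for e
      using that by (auto simp: fun_eq_iff PiE_def extensional_def)
    have "?F \<in> ?I \<rightarrow>\<^sub>E UNIV" "?O \<in> ?I \<rightarrow>\<^sub>E UNIV" by auto
    then show ?thesis
      unfolding satisfies_braid_refl_tuple_iff[OF m t] using F O by auto
  qed
  moreover have "?F \<noteq> ?O" if "m = 4"
  proof
    assume eq: "?F = ?O"
    have evens: "int m dvd 2 * t p" if "p \<in> ?I" for p
    proof -
      have "even (t p)" using fun_cong[OF eq, of p] that by simp
      then show ?thesis using \<open>m = 4\<close> by (auto elim!: evenE)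
    qed
    have "m > 0" using m by simp
    then have "int m dvd 2" using t evens by (rule generating_integer_mod_annihilator)
    then show False using that by simp
  qed
  ultimately show ?thesis by simp
qed

subsection \<open>Tuples with a rotation at \<open>\<sigma>\<close>\<close>

text \<open>
  The relations evaluated in normal form (coordinates relative to \<open>k = 0\<close>) when \<open>\<sigma>\<close> is sent to the
  rotation \<open>y\<^sup>r\<close>: conjugation by \<open>y\<^sup>r\<close> fixes rotations and shifts the exponent of a reflection by \<open>2 r\<close>.
\<close>

lemma handle_relations_rotation:
  assumes m: "m > 0" and s: "c Gen_sigma = refl_coord m 0 False r"
    and c: "\<forall>p\<in>handle_gens g. c p = refl_coord m 0 (e p) (t p)"
    and rel: "handle_relations (dih m) g c"
  shows "p \<in> handle_gens g \<Longrightarrow> q \<in> handle_gens g \<Longrightarrow> handle q < handle p \<Longrightarrow>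
      int m dvd 2 * ((if e q then t p else 0) - (if e p then if e q then t q + 2 * r else t q else 0))"
    and "i \<in> {1..g} \<Longrightarrow>
      int m dvd 2 * ((if e (Gen_a i) then if e (Gen_b i) then t (Gen_b i) else t (Gen_b i) - 2 * r else 0)
        - (if e (Gen_b i) then t (Gen_a i) else 0) - (if e (Gen_a i) = e (Gen_b i) then r else - r))"
proof -
  have s': "inv\<^bsub>dih m\<^esub> c Gen_sigma = refl_coord m 0 False (- r)" using m s by simp
  {
    assume pq: "p \<in> handle_gens g" "q \<in> handle_gens g" "handle q < handle p"
    then have "c p \<otimes>\<^bsub>dih m\<^esub> (inv\<^bsub>dih m\<^esub> c Gen_sigma \<otimes>\<^bsub>dih m\<^esub> (c q \<otimes>\<^bsub>dih m\<^esub> c Gen_sigma)) =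
        inv\<^bsub>dih m\<^esub> c Gen_sigma \<otimes>\<^bsub>dih m\<^esub> (c q \<otimes>\<^bsub>dih m\<^esub> c Gen_sigma) \<otimes>\<^bsub>dih m\<^esub> c p"
      using rel unfolding handle_relations_def Let_def by blast
    moreover have "inv\<^bsub>dih m\<^esub> c Gen_sigma \<otimes>\<^bsub>dih m\<^esub> (c q \<otimes>\<^bsub>dih m\<^esub> c Gen_sigma) =
        refl_coord m 0 (e q) (if e q then t q + 2 * r else t q)"
      unfolding s' unfolding s c[rule_format, OF pq(2)] by (cases "e q") simp_all
    ultimately show "int m dvd 2 * ((if e q then t p else 0) - (if e p then if e q then t q + 2 * r else t q else 0))"
      using refl_coord_commute_iff[OF m, of 0 "e p" "t p" "e q" "if e q then t q + 2 * r else t q"] c[rule_format, OF pq(1)]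
      by metis
  next
    assume i: "i \<in> {1..g}"
    let ?a = "Gen_a i" and ?b = "Gen_b i"
    have ab: "?a \<in> handle_gens g" "?b \<in> handle_gens g" using i by auto
    have "c ?a \<otimes>\<^bsub>dih m\<^esub> (inv\<^bsub>dih m\<^esub> c Gen_sigma \<otimes>\<^bsub>dih m\<^esub> (c ?b \<otimes>\<^bsub>dih m\<^esub> inv\<^bsub>dih m\<^esub> c Gen_sigma)) =
        c Gen_sigma \<otimes>\<^bsub>dih m\<^esub> c Gen_sigma \<otimes>\<^bsub>dih m\<^esub>
          (inv\<^bsub>dih m\<^esub> c Gen_sigma \<otimes>\<^bsub>dih m\<^esub> (c ?b \<otimes>\<^bsub>dih m\<^esub> inv\<^bsub>dih m\<^esub> c Gen_sigma) \<otimes>\<^bsub>dih m\<^esub> c ?a)"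
      using rel i unfolding handle_relations_def Let_def by blast
    moreover have "inv\<^bsub>dih m\<^esub> c Gen_sigma \<otimes>\<^bsub>dih m\<^esub> (c ?b \<otimes>\<^bsub>dih m\<^esub> inv\<^bsub>dih m\<^esub> c Gen_sigma) =
        refl_coord m 0 (e ?b) (if e ?b then t ?b else t ?b - 2 * r)"
      unfolding s' c[rule_format, OF ab(2)] by (cases "e ?b") simp_all
    ultimately have "refl_coord m 0 (e ?a) (t ?a) \<otimes>\<^bsub>dih m\<^esub> refl_coord m 0 (e ?b) (if e ?b then t ?b else t ?b - 2 * r) =
        refl_coord m 0 False (2 * r) \<otimes>\<^bsub>dih m\<^esub> (refl_coord m 0 (e ?b) (if e ?b then t ?b else t ?b - 2 * r)
          \<otimes>\<^bsub>dih m\<^esub> refl_coord m 0 (e ?a) (t ?a))"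
      using s c[rule_format, OF ab(1)] by simp
    then show "int m dvd 2 * ((if e ?a then if e ?b then t ?b else t ?b - 2 * r else 0)
        - (if e ?b then t ?a else 0) - (if e ?a = e ?b then r else - r))"
      by (cases "e ?a"; cases "e ?b") (simp_all add: algebra_simps)
  }
qed

lemma dvd_linear_combination:
  fixes d x y :: int
  assumes "d dvd x" "d dvd y" "z = a * x + b * y"
  shows "d dvd z"
  using assms by simp

text \<open>
  Suppose \<open>\<sigma>\<close> goes to the rotation \<open>y\<^sup>r\<close>.  The crucial step is \<open>2 r = 0\<close>: it makes the image of \<open>\<sigma>\<close>
  central, so that the relations turn into plain commutation.  Then all entries commute with some
  reflection among them, so they generate at most a group of exponent 2, which is too small for
  \<open>m \<ge> 3\<close>.
\<close>

lemma sigma_reflection: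
  assumes m: "m \<ge> 3" and g: "g \<ge> 2"
    and gen: "c \<in> generating_tuples (dih m) (braid_gens g)"
    and rel: "handle_relations (dih m) g c"
  shows "fst (c Gen_sigma)"
proof (rule ccontr)
  assume rot: "\<not> fst (c Gen_sigma)"
  have m0: "m > 0" using m by simp
  let ?I = "handle_gens g"
  have car: "c p \<in> carrier (dih m)" if "p \<in> braid_gens g" for p
    using gen that by (auto simp: generating_tuples_def)
  define e where "e = (\<lambda>p. fst (c p))"
  define t where "t = (\<lambda>p. snd (c p))"
  have c: "c p = refl_coord m 0 (e p) (t p)" if "p \<in> braid_gens g" for p
    using car[OF that] by (cases "c p") (simp add: refl_coord_def e_def t_def carrier_dih)
  have cI: "\<forall>p\<in>?I. c p = refl_coord m 0 (e p) (t p)"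
    using c by (simp add: braid_gens_eq)
  define r where "r = t Gen_sigma"
  have s: "c Gen_sigma = refl_coord m 0 False r"
    using c[of Gen_sigma] rot by (simp add: braid_gens_eq r_def e_def)
  note R = handle_relations_rotation[OF m0 s cI rel]
  \<comment> \<open>If the first handle consists of rotations, its commutator is trivial and equals \<open>\<sigma>\<^sup>2\<close>.  Otherwise
    it contains a reflection, a conjugate of which commutes with both generators of the second
    handle; this makes the commutator in the second handle trivial up to powers of \<open>y\<^sup>r\<close>.\<close>
  have r2: "int m dvd 2 * r"
  proof (cases "e (Gen_a 1) \<or> e (Gen_b 1)")
    case False
    then show ?thesis using R(2)[of 1] g by simp
  next
    case True
    then obtain q where q: "q \<in> ?I" "e q" "handle q = 1" using g by (metis One_nat_def Suc_leD
          atLeastAtMost_iff handle.simps(1,2) handle_gens_simps(1,2) le_refl numeral_2_eq_2)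
    let ?a = "Gen_a 2" and ?b = "Gen_b 2"
    have ab: "?a \<in> ?I" "?b \<in> ?I" using g by auto
    have a: "int m dvd 2 * (t ?a - (if e ?a then t q + 2 * r else 0))"
      and b: "int m dvd 2 * (t ?b - (if e ?b then t q + 2 * r else 0))"
      using R(1)[OF ab(1) q(1)] R(1)[OF ab(2) q(1)] by (simp_all add: q(2,3) split: if_splits)
    have d: "int m dvd 2 * (t ?a - (if e ?a then t q + 2 * r else 0)) - 2 * (t ?b - (if e ?b then t q + 2 * r else 0))"
      using a b by (rule dvd_diff)
    have h: "int m dvd 2 * ((if e ?a then if e ?b then t ?b else t ?b - 2 * r else 0)
        - (if e ?b then t ?a else 0) - (if e ?a = e ?b then r else - r))"
      using R(2)[of 2] g by simp
    \<comment> \<open>In each case \<open>h\<close> expresses a multiple of \<open>r\<close> through exponents that \<open>a\<close>, \<open>b\<close> or their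
      difference \<open>d\<close> eliminates.\<close>
    consider "e ?a" "e ?b" | "e ?a" "\<not> e ?b" | "\<not> e ?a" "e ?b" | "\<not> e ?a" "\<not> e ?b" by blast
    then show ?thesis
    proof cases
      case 1
      show ?thesis by (rule dvd_linear_combination[OF d h, of _ "-1" "-1"]) (simp add: 1 algebra_simps)
    next
      case 2
      show ?thesis by (rule dvd_linear_combination[OF b h, of _ 1 "-1"]) (simp add: 2 algebra_simps)
    next
      case 3
      show ?thesis by (rule dvd_linear_combination[OF a h, of _ 1 1]) (simp add: 3 algebra_simps)
    next
      case 4
      then show ?thesis using h by simp
    qed
  qed
  have r4: "int m dvd 4 * r" using dvd_mult[OF r2, of 2] by simp
  define d where "d p q \<longleftrightarrow> int m dvd 2 * ((if e q then t p else 0) - (if e p then t q else 0))" for p q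
  have flip: "d p q \<longleftrightarrow> d q p" for p q
    unfolding d_def using dvd_minus_iff[of "int m" "2 * ((if e q then t p else 0) - (if e p then t q else 0))"]
    by (simp add: algebra_simps)
  have handles: "d p q" if "p \<in> ?I" "q \<in> ?I" "handle q < handle p" for p q
    unfolding d_def
    by (rule dvd_linear_combination[OF R(1)[OF that] r4, of _ 1 "if e p \<and> e q then 1 else 0"]) (simp add: algebra_simps)
  have ab: "d (Gen_a i) (Gen_b i)" if "i \<in> {1..g}" for i
    unfolding d_def
    by (rule dvd_linear_combination[OF R(2)[OF that] r2, of _ "-1"
          "if e (Gen_a i) = e (Gen_b i) then -1 else if e (Gen_a i) then -1 else 1"])
      (simp add: algebra_simps)
  have comm: "d p q" if pq: "p \<in> ?I" "q \<in> ?I" for p q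
  proof -
    have "p = q \<or> handle q < handle p \<or> handle p < handle q \<or>
        (\<exists>i\<in>{1..g}. p = Gen_a i \<and> q = Gen_b i \<or> q = Gen_a i \<and> p = Gen_b i)"
      using pq by (cases p; cases q) auto
    moreover have "d p p" by (simp add: d_def)
    ultimately show ?thesis using handles pq ab flip by blast
  qed
  \<comment> \<open>Relative to a reflection among the entries, all exponents are killed by 2.\<close>
  obtain p0 where "p0 \<in> braid_gens g" "e p0"
    using generating_dih_reflection[OF m0 gen] by (auto simp: e_def)
  then have p0: "p0 \<in> ?I" "e p0" using rot by (auto simp: braid_gens_eq e_def)
  have "int m dvd 2"
  proof (rule generating_dih_annihilator[OF m0 gen])
    fix x assume x: "x \<in> braid_gens g"
    have "c x = refl_coord m (t p0) (e x) (t x - (if e x then t p0 else 0))"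
      using c[OF x] by (auto simp: refl_coord_def)
    moreover have "int m dvd 2 * (t x - (if e x then t p0 else 0))"
    proof (cases "x = Gen_sigma")
      case True
      then show ?thesis using r2 rot by (simp add: r_def e_def)
    next
      case False
      then show ?thesis using comm[of x p0] p0 x by (simp add: braid_gens_eq d_def)
    qed
    ultimately show "\<exists>f u. c x = refl_coord m (t p0) f u \<and> int m dvd 2 * u" by blast
  qed
  then show False using m zdvd_imp_le by fastforce
qed


section \<open>Counting admissible epimorphisms\<close>

lemma bij_betw_restrict_Collect:
  assumes "bij_betw f A B" and "\<And>x. x \<in> A \<Longrightarrow> P x \<longleftrightarrow> Q (f x)"
  shows "bij_betw f {x \<in> A. P x} {y \<in> B. Q y}"
  using assms by (auto simp: bij_betw_def inj_on_def)

lemma finite_carrier_dihedral_group: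
  assumes "m > 0"
  shows "finite (carrier (dihedral_group m))"
proof -
  obtain h where "h \<in> iso (dihedral_group m) (dih m)" using dihedral_group_iso_dih[OF assms] by blast
  then show ?thesis by (auto simp: iso_def carrier_dih dest!: bij_betw_finite)
qed

text \<open>
  In a finite group an element has order at least 2 exactly when it is not the identity, and this
  condition on the image of \<open>\<sigma>\<close> survives both the passage to the isomorphic model and the
  restriction to generators.
\<close>

lemma bij_betw_admissible_epis:
  assumes m: "m > 0"
  shows "\<exists>F. bij_betw F (admissible_epis g (dihedral_group m))
    {c \<in> generating_tuples (dih m) (braid_gens g).
       satisfies (dih m) (braid_gens g) (braid_rels g) c \<and> c Gen_sigma \<noteq> \<one>\<^bsub>dih m\<^esub>}"
proof -
  let ?D = "dihedral_group m" and ?B = "braid_group g"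
  obtain h where h: "h \<in> iso ?D (dih m)" using dihedral_group_iso_dih[OF m] by blast
  have D: "group ?D" by (rule group_dihedral_group)
  have H: "group (dih m)" by (rule group_dih[OF m])
  interpret h: group_hom ?D "dih m" h
    using h D H by (simp add: group_hom_def group_hom_axioms_def iso_def)
  let ?comp = "compose (carrier ?B) h"
  let ?res = "\<lambda>\<phi>. \<lambda>x\<in>braid_gens g. \<phi> (word_class (braid_gens g) (braid_rels g) (letter x))"
  have adm: "admissible_epis g ?D =
      {\<phi> \<in> epi ?B ?D \<inter> extensional (carrier ?B). \<phi> (braid_sigma g) \<noteq> \<one>\<^bsub>?D\<^esub>}"
    unfolding admissible_epis_def
    using ord_ge_2_iff[OF D finite_carrier_dihedral_group[OF m]] braid_sigma_closed[of g]
    by (auto simp: epi_def hom_def Pi_iff)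
  have comp: "bij_betw ?comp {\<phi> \<in> epi ?B ?D \<inter> extensional (carrier ?B). \<phi> (braid_sigma g) \<noteq> \<one>\<^bsub>?D\<^esub>}
      {\<phi> \<in> epi ?B (dih m) \<inter> extensional (carrier ?B). \<phi> (braid_sigma g) \<noteq> \<one>\<^bsub>dih m\<^esub>}"
  proof (rule bij_betw_restrict_Collect[OF bij_betw_epi_iso[OF group_braid_group D H h]])
    fix \<phi> assume "\<phi> \<in> epi ?B ?D \<inter> extensional (carrier ?B)"
    then have p: "\<phi> (braid_sigma g) \<in> carrier ?D"
      using braid_sigma_closed[of g] by (auto simp: epi_def hom_def Pi_iff)
    have "inj_on h (carrier ?D)" using h by (simp add: iso_def bij_betw_def)
    then have "h (\<phi> (braid_sigma g)) = h \<one>\<^bsub>?D\<^esub> \<longleftrightarrow> \<phi> (braid_sigma g) = \<one>\<^bsub>?D\<^esub>"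
      using p by (simp add: inj_on_eq_iff del: h.hom_one)
    then show "\<phi> (braid_sigma g) \<noteq> \<one>\<^bsub>?D\<^esub> \<longleftrightarrow> ?comp \<phi> (braid_sigma g) \<noteq> \<one>\<^bsub>dih m\<^esub>"
      using braid_sigma_closed[of g] by (simp add: compose_eq)
  qed
  have res: "bij_betw ?res {\<phi> \<in> epi ?B (dih m) \<inter> extensional (carrier ?B). \<phi> (braid_sigma g) \<noteq> \<one>\<^bsub>dih m\<^esub>}
      {c \<in> {c \<in> generating_tuples (dih m) (braid_gens g). satisfies (dih m) (braid_gens g) (braid_rels g) c}.
        c Gen_sigma \<noteq> \<one>\<^bsub>dih m\<^esub>}"
    unfolding braid_group_def
    by (rule bij_betw_restrict_Collect[OF bij_betw_epis_tuples[OF H]])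
      (simp add: braid_sigma_def braid_gens_eq)
  show ?thesis
    using bij_betw_trans[OF comp res] unfolding adm by (intro exI) (simp add: conj_assoc)
qed

lemma num_admissible_epis_eq:
  assumes "m > 0"
  shows "finite (admissible_epis g (dihedral_group m))"
    and "num_admissible_epis g (dihedral_group m) =
      card {c \<in> generating_tuples (dih m) (braid_gens g).
       satisfies (dih m) (braid_gens g) (braid_rels g) c \<and> c Gen_sigma \<noteq> \<one>\<^bsub>dih m\<^esub>}"
proof -
  obtain F where F: "bij_betw F (admissible_epis g (dihedral_group m))
      {c \<in> generating_tuples (dih m) (braid_gens g).
       satisfies (dih m) (braid_gens g) (braid_rels g) c \<and> c Gen_sigma \<noteq> \<one>\<^bsub>dih m\<^esub>}"
    using bij_betw_admissible_epis[OF assms] by blast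
  have "finite (generating_tuples (dih m) (braid_gens g))"
    by (rule finite_generating_tuples) (simp_all add: carrier_dih braid_gens_eq)
  then show "finite (admissible_epis g (dihedral_group m))"
    using bij_betw_finite[OF F] by simp
  show "num_admissible_epis g (dihedral_group m) =
      card {c \<in> generating_tuples (dih m) (braid_gens g).
       satisfies (dih m) (braid_gens g) (braid_rels g) c \<and> c Gen_sigma \<noteq> \<one>\<^bsub>dih m\<^esub>}"
    unfolding num_admissible_epis_def by (rule bij_betw_same_card[OF F])
qed

lemma order_AutoGroup_eq:
  assumes m: "m > 0"
  shows "order (AutoGroup (dihedral_group m)) =
    card {c \<in> generating_tuples (dih m) {Gen_x, Gen_y}. satisfies (dih m) {Gen_x, Gen_y} (dihedral_rels m) c}"
proof -
  let ?D = "dihedral_group m"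
  obtain h where h: "h \<in> iso ?D (dih m)" using dihedral_group_iso_dih[OF m] by blast
  have D: "group ?D" by (rule group_dihedral_group)
  have H: "group (dih m)" by (rule group_dih[OF m])
  have "order (AutoGroup ?D) = card (epi ?D ?D \<inter> extensional (carrier ?D))"
    by (simp add: order_def AutoGroup_def auto_finite[OF finite_carrier_dihedral_group[OF m]])
  also have "\<dots> = card (epi ?D (dih m) \<inter> extensional (carrier ?D))"
    by (rule bij_betw_same_card[OF bij_betw_epi_iso[OF D D H h]])
  also have "\<dots> = card {c \<in> generating_tuples (dih m) {Gen_x, Gen_y}.
      satisfies (dih m) {Gen_x, Gen_y} (dihedral_rels m) c}"
    unfolding dihedral_group_def by (rule bij_betw_same_card[OF bij_betw_epis_tuples[OF H]])
  finally show ?thesis .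
qed

subsection \<open>The Klein four-group\<close>

lemma dih_2_comm:
  assumes "p \<in> carrier (dih 2)" "q \<in> carrier (dih 2)"
  shows "p \<otimes>\<^bsub>dih 2\<^esub> q = q \<otimes>\<^bsub>dih 2\<^esub> p" and "p \<otimes>\<^bsub>dih 2\<^esub> p = \<one>\<^bsub>dih 2\<^esub>"
proof -
  obtain e j f k where *: "p = (e, j)" "q = (f, k)" by fastforce
  moreover have "j = 0 \<or> j = 1" "k = 0 \<or> k = 1" using assms by (auto simp: * carrier_dih)
  ultimately show "p \<otimes>\<^bsub>dih 2\<^esub> q = q \<otimes>\<^bsub>dih 2\<^esub> p" "p \<otimes>\<^bsub>dih 2\<^esub> p = \<one>\<^bsub>dih 2\<^esub>" by auto
qed

lemma satisfies_braid_rels_klein: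
  assumes c: "c \<in> braid_gens g \<rightarrow> carrier (dih 2)"
  shows "satisfies (dih 2) (braid_gens g) (braid_rels g) c"
proof -
  interpret H: group "dih 2" by (rule group_dih) simp
  have s: "c Gen_sigma \<in> carrier (dih 2)" using c by (auto simp: braid_gens_eq)
  have cI: "c p \<in> carrier (dih 2)" if "p \<in> handle_gens g" for p
    using c that by (auto simp: braid_gens_eq)
  note comm = dih_2_comm(1)
  show ?thesis
  proof (rule H.satisfies_braid_relsI[OF c])
    have ss: "c Gen_sigma \<otimes>\<^bsub>dih 2\<^esub> c Gen_sigma = \<one>\<^bsub>dih 2\<^esub>" using dih_2_comm(2)[OF s s] .
    then show "c Gen_sigma \<otimes>\<^bsub>dih 2\<^esub> c Gen_sigma = \<one>\<^bsub>dih 2\<^esub>" .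
    show "handle_relations (dih 2) g c"
      unfolding handle_relations_def Let_def ss using s cI
      by (intro conjI ballI impI) (simp_all add: comm del: one_dih)
    fix i assume "i \<in> {1..g}"
    then show "c (Gen_a i) \<otimes>\<^bsub>dih 2\<^esub> inv\<^bsub>dih 2\<^esub> c (Gen_b i) = inv\<^bsub>dih 2\<^esub> c (Gen_b i) \<otimes>\<^bsub>dih 2\<^esub> c (Gen_a i)"
      using cI by (intro comm) auto
  qed
qed

lemma satisfies_dihedral_rels_klein:
  assumes c: "c \<in> {Gen_x, Gen_y} \<rightarrow> carrier (dih 2)"
  shows "satisfies (dih 2) {Gen_x, Gen_y} (dihedral_rels 2) c"
proof -
  interpret H: group "dih 2" by (rule group_dih) simp
  have xy: "c Gen_x \<in> carrier (dih 2)" "c Gen_y \<in> carrier (dih 2)" using c by auto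
  have "inv\<^bsub>dih 2\<^esub> c Gen_y = c Gen_y"
    by (rule H.inv_equality) (use dih_2_comm(2) xy in auto)
  moreover have "c Gen_x \<otimes>\<^bsub>dih 2\<^esub> c Gen_y \<otimes>\<^bsub>dih 2\<^esub> inv\<^bsub>dih 2\<^esub> c Gen_x = c Gen_y"
    using xy dih_2_comm(1)[of "c Gen_x" "c Gen_y"] by (simp add: H.m_assoc del: one_dih)
  moreover have "c Gen_y [^]\<^bsub>dih 2\<^esub> (2::nat) = \<one>\<^bsub>dih 2\<^esub>"
  proof -
    have "c Gen_y [^]\<^bsub>dih 2\<^esub> Suc (Suc 0) = \<one>\<^bsub>dih 2\<^esub>"
      using xy dih_2_comm(2)[of "c Gen_y" "c Gen_y"] by (simp del: one_dih)
    then show ?thesis by (simp only: numeral_2_eq_2)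
  qed
  ultimately show ?thesis
    using H.satisfies_dihedral_rels[OF c, of 2] xy dih_2_comm(2)[of "c Gen_x"] by simp
qed

subsection \<open>Generating pairs of dihedral groups\<close>

text \<open>
  If \<open>x\<close> went to a rotation \<open>y\<^sup>j\<close>, then \<open>y\<close> would have to go to a reflection \<open>s\<close>, and \<open>2 j = 0\<close> by
  \<open>x\<^sup>2 = 1\<close>.  The image would then be contained in \<open>A \<union> s A\<close> with \<open>A\<close> of exponent 2, or trivial if
  \<open>j = 0\<close>.  The alternative in which \<open>x\<close> goes to the identity serves \<open>m = 2\<close>, where \<open>x\<close> may go to a
  non-trivial rotation.
\<close>

lemma generating_pair_x_reflection:
  assumes m: "m \<ge> 2" and gen: "c \<in> generating_tuples (dih m) {Gen_x, Gen_y}"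
    and x: "c Gen_x = \<one>\<^bsub>dih m\<^esub> \<or> m \<ge> 3 \<and> satisfies (dih m) {Gen_x, Gen_y} (dihedral_rels m) c"
  shows "fst (c Gen_x)"
proof (rule ccontr)
  assume rot: "\<not> fst (c Gen_x)"
  have m0: "m > 0" using m by simp
  interpret H: group "dih m" by (rule group_dih[OF m0])
  have c: "c \<in> {Gen_x, Gen_y} \<rightarrow> carrier (dih m)" using gen by (auto simp: generating_tuples_def)
  obtain j where j: "c Gen_x = (False, j)" "j \<in> {0..<int m}"
    using rot c by (cases "c Gen_x") (auto simp: carrier_dih)
  have "fst (c Gen_y)" using generating_dih_reflection[OF m0 gen] rot by auto
  then obtain k where k: "c Gen_y = (True, k)" "k \<in> {0..<int m}"
    using c by (cases "c Gen_y") (auto simp: carrier_dih)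
  define q where "q = (if j = 0 then 1 else 2 :: int)"
  have qj: "int m dvd q * j"
  proof (cases "j = 0")
    case False
    then have "c Gen_x \<otimes>\<^bsub>dih m\<^esub> c Gen_x = \<one>\<^bsub>dih m\<^esub>"
      using x H.satisfies_dihedral_rels[OF c, of m] j by auto
    then show ?thesis using j False by (simp add: q_def dvd_eq_mod_eq_0)
  qed simp
  have "int m dvd q"
  proof (rule generating_dih_annihilator[OF m0 gen])
    fix z assume "z \<in> {Gen_x, Gen_y}"
    moreover have "c Gen_x = refl_coord m k False j" "c Gen_y = refl_coord m k True 0"
      using j k by (auto simp: refl_coord_def)
    ultimately show "\<exists>e t. c z = refl_coord m k e t \<and> int m dvd q * t"
      using qj by (metis dvd_0_right insert_iff mult_zero_right singletonD)
  qed
  moreover have "j \<noteq> 0 \<Longrightarrow> m \<ge> 3" using x j by auto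
  ultimately show False using m zdvd_imp_le[of "int m" q] by (auto simp: q_def split: if_splits)
qed

text \<open>
  If \<open>y\<close> went to a reflection \<open>s y\<^sup>t\<close>, the relation \<open>s y s\<^sup>-\<^sup>1 = y\<^sup>-\<^sup>1\<close> would read \<open>2 t = 0\<close>, but \<open>t\<close> generates
  \<open>C\<^sub>m\<close> and \<open>m \<ge> 3\<close>.
\<close>

lemma satisfies_dihedral_refl_tuple_iff:
  assumes m: "m \<ge> 3" and t: "t \<in> generating_tuples (integer_mod_group m) {Gen_y}"
  shows "satisfies (dih m) {Gen_x, Gen_y} (dihedral_rels m) (refl_tuple m Gen_x {Gen_y} k e t) \<longleftrightarrow> \<not> e Gen_y"
proof -
  let ?c = "refl_tuple m Gen_x {Gen_y} k e t"
  have m0: "m > 0" using m by simp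
  interpret H: group "dih m" by (rule group_dih[OF m0])
  have c: "?c \<in> {Gen_x, Gen_y} \<rightarrow> carrier (dih m)" using m0 by (auto simp: refl_tuple_def)
  have x: "?c Gen_x = refl_coord m k True 0" and y: "?c Gen_y = refl_coord m k (e Gen_y) (t Gen_y)"
    by (auto simp: refl_tuple_def)
  have ndvd: "\<not> int m dvd 2 * t Gen_y"
  proof
    assume "int m dvd 2 * t Gen_y"
    then have "int m dvd 2" using generating_integer_mod_annihilator[OF m0 t, of 2] by simp
    then show False using m zdvd_imp_le[of "int m" 2] by simp
  qed
  have pow: "refl_coord m k False u [^]\<^bsub>dih m\<^esub> m = \<one>\<^bsub>dih m\<^esub>" for u
    using pow_dih[OF m0, of "u mod int m" m] by (simp add: refl_coord_def)
  show ?thesis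
    unfolding H.satisfies_dihedral_rels[OF c] x y
    using ndvd m0 pow[of "t Gen_y"] by (cases "e Gen_y") (auto simp: one_refl_coord[of m k] simp del: one_dih)
qed

text \<open>
  With \<open>d\<close> the greatest common divisor of \<open>z\<close> and \<open>m\<close>, the number \<open>m / d\<close> kills \<open>z\<close>, so it is divisible
  by \<open>m\<close> if \<open>z\<close> generates.
\<close>

lemma generate_integer_mod_singleton:
  assumes m: "m > 0" and z: "z \<in> {0..<int m}"
  shows "generate (integer_mod_group m) {z} = carrier (integer_mod_group m) \<longleftrightarrow> coprime z (int m)"
proof
  have car: "carrier (integer_mod_group m) = {0..<int m}" using m by (simp add: carrier_integer_mod_group)
  interpret Z: group "integer_mod_group m" by simp
  {
    assume "generate (integer_mod_group m) {z} = carrier (integer_mod_group m)"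
    then have t: "(\<lambda>_\<in>{()}. z) \<in> generating_tuples (integer_mod_group m) {()}"
      using z by (simp add: generating_tuples_def car)
    define d where "d = gcd z (int m)"
    define k where "k = int m div d"
    have dk: "d * k = int m" by (simp add: d_def k_def)
    have d0: "d > 0" using m by (simp add: d_def)
    have k0: "k > 0" using dk m d0 by (metis of_nat_0_less_iff zero_less_mult_pos)
    have "k * z = int m * (z div d)"
      by (simp add: d_def k_def dvd_div_mult div_mult_swap)
    then have "int m dvd k"
      using generating_integer_mod_annihilator[OF m t, of k] by simp
    then have "d * k \<le> 1 * k" using k0 dk zdvd_imp_le by simp
    then have "d = 1" using k0 d0 mult_right_le_imp_le[of d k 1] by simp
    then show "coprime z (int m)" by (simp add: d_def coprime_iff_gcd_eq_1)
  next
    assume "coprime z (int m)"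
    then obtain u where u: "[z * u = 1] (mod int m)" using cong_solve_coprime_int by blast
    have "w \<in> generate (integer_mod_group m) {z}" if "w \<in> {0..<int m}" for w
    proof -
      have "[(w * u) * z = w * 1] (mod int m)"
        using cong_scalar_left[OF u, of w] by (simp add: ac_simps)
      then have "z [^]\<^bsub>integer_mod_group m\<^esub> (w * u) = w"
        using that by (simp add: int_pow_integer_mod_group cong_def)
      moreover have "z [^]\<^bsub>integer_mod_group m\<^esub> (w * u) \<in> generate (integer_mod_group m) {z}"
        using Z.generate_pow[of z] z car by auto
      ultimately show ?thesis by simp
    qed
    then show "generate (integer_mod_group m) {z} = carrier (integer_mod_group m)"
      using Z.generate_incl[of "{z}"] z car by auto
  }
qed

lemma jordan_totient_1:
  assumes m: "m \<ge> 2"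
  shows "jordan_totient 1 m = totient m"
proof -
  have car: "carrier (integer_mod_group m) = {0..<int m}" using m by (simp add: carrier_integer_mod_group)
  have gen: "t \<in> generating_tuples (integer_mod_group m) {()} \<longleftrightarrow>
      t () \<in> {0..<int m} \<and> coprime (t ()) (int m)" for t
    using generate_integer_mod_singleton[of m "t ()"] m
    by (auto simp: generating_tuples_def car PiE_def extensional_def)
  have "bij_betw (\<lambda>t. nat (t ())) (generating_tuples (integer_mod_group m) {()}) (totatives m)"
  proof (rule bij_betwI[where g = "\<lambda>k _. int k"])
    show "(\<lambda>t. nat (t ())) \<in> generating_tuples (integer_mod_group m) {()} \<rightarrow> totatives m"
    proof
      fix t assume "t \<in> generating_tuples (integer_mod_group m) {()}"
      then have t: "0 \<le> t ()" "t () < int m" "coprime (t ()) (int m)" by (auto simp: gen)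
      moreover have "t () \<noteq> 0" using t(3) m by auto
      moreover have "coprime (nat (t ())) m" using t by (simp flip: coprime_int_iff)
      ultimately show "nat (t ()) \<in> totatives m" by (auto simp: in_totatives_iff)
    qed
    show "(\<lambda>k _. int k) \<in> totatives m \<rightarrow> generating_tuples (integer_mod_group m) {()}"
    proof
      fix k assume "k \<in> totatives m"
      then have k: "k \<le> m" "coprime k m" by (auto simp: in_totatives_iff)
      then have "k < m" using m by (cases "k = m") auto
      then show "(\<lambda>_. int k) \<in> generating_tuples (integer_mod_group m) {()}" using k by (simp add: gen)
    qed
  qed (auto simp: gen fun_eq_iff)
  then have "card (generating_tuples (integer_mod_group m) {()}) = totient m"
    by (simp add: bij_betw_same_card totient_def)
  then show ?thesis using card_generating_tuples_integer_mod[of "{()}" m] by simp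
qed

text \<open>
  An automorphism is a generating pair of images of \<open>x\<close> and \<open>y\<close> satisfying the relations, so the
  counts of tuples apply with \<open>x\<close> in the distinguished position and \<open>I = {y}\<close>.
\<close>

lemma order_AutoGroup_dihedral:
  assumes m: "m \<ge> 2"
  shows "order (AutoGroup (dihedral_group m)) = (if m = 2 then 6 else m * totient m)"
proof (cases "m = 2")
  case True
  have "{c \<in> generating_tuples (dih 2) {Gen_x, Gen_y}. satisfies (dih 2) {Gen_x, Gen_y} (dihedral_rels 2) c} =
      {c \<in> generating_tuples (dih 2) {Gen_x, Gen_y}. c Gen_x \<noteq> \<one>\<^bsub>dih 2\<^esub>}"
  proof -
    have "c Gen_x \<noteq> \<one>\<^bsub>dih 2\<^esub>" if "c \<in> generating_tuples (dih 2) {Gen_x, Gen_y}" for c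
      using generating_pair_x_reflection[of 2 c] that by auto
    moreover have "satisfies (dih 2) {Gen_x, Gen_y} (dihedral_rels 2) c"
      if "c \<in> generating_tuples (dih 2) {Gen_x, Gen_y}" for c
      using that by (intro satisfies_dihedral_rels_klein) (auto simp: generating_tuples_def)
    ultimately show ?thesis by blast
  qed
  also have "card \<dots> = 6"
    using card_tuples_klein[of "{Gen_y}" Gen_x] jordan_totient_1[of 2] by (simp add: totient_2)
  finally show ?thesis using True by (simp add: order_AutoGroup_eq)
next
  case False
  then have m3: "m \<ge> 3" using m by simp
  have m0: "m > 0" using m by simp
  have "card {c \<in> generating_tuples (dih m) (insert Gen_x {Gen_y}). satisfies (dih m) {Gen_x, Gen_y} (dihedral_rels m) c} =
      m * jordan_totient (card {Gen_y}) m * 1"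
  proof (rule card_tuples_reflection[OF m0])
    fix t k assume t: "t \<in> generating_tuples (integer_mod_group m) {Gen_y}"
    have "{e \<in> {Gen_y} \<rightarrow>\<^sub>E UNIV. \<not> e Gen_y} = {\<lambda>y\<in>{Gen_y}. False}"
      by (auto simp: fun_eq_iff PiE_def extensional_def)
    then show "card {e \<in> {Gen_y} \<rightarrow>\<^sub>E UNIV. satisfies (dih m) {Gen_x, Gen_y} (dihedral_rels m)
        (refl_tuple m Gen_x {Gen_y} k e t)} = 1"
      unfolding satisfies_dihedral_refl_tuple_iff[OF m3 t] by simp
  qed (use generating_pair_x_reflection[OF m] m3 in auto)
  then show ?thesis using False by (simp add: order_AutoGroup_eq[OF m0] jordan_totient_1[OF m, unfolded One_nat_def])
qed

subsection \<open>The number of admissible epimorphisms\<close>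

lemma num_admissible_epis_dihedral:
  assumes g: "g \<ge> 2" and m: "m \<ge> 2"
  shows "num_admissible_epis g (dihedral_group m) =
    (if m = 2 then 3 * jordan_totient (2 * g) 2 * 2 ^ (2 * g)
     else m * jordan_totient (2 * g) m * (if m = 4 then 2 else 1))"
proof (cases "m = 2")
  case True
  have "{c \<in> generating_tuples (dih 2) (braid_gens g).
      satisfies (dih 2) (braid_gens g) (braid_rels g) c \<and> c Gen_sigma \<noteq> \<one>\<^bsub>dih 2\<^esub>} =
      {c \<in> generating_tuples (dih 2) (insert Gen_sigma (handle_gens g)). c Gen_sigma \<noteq> \<one>\<^bsub>dih 2\<^esub>}"
    using satisfies_braid_rels_klein[of _ g] by (auto simp: generating_tuples_def braid_gens_eq)
  then show ?thesis
    using True card_tuples_klein[of "handle_gens g" Gen_sigma]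
    by (simp add: num_admissible_epis_eq card_handle_gens)
next
  case False
  then have m3: "m \<ge> 3" using m by simp
  have m0: "m > 0" using m by simp
  interpret H: group "dih m" by (rule group_dih[OF m0])
  let ?P = "\<lambda>c. satisfies (dih m) (braid_gens g) (braid_rels g) c \<and> c Gen_sigma \<noteq> \<one>\<^bsub>dih m\<^esub>"
  have "card {c \<in> generating_tuples (dih m) (insert Gen_sigma (handle_gens g)). ?P c} =
      m * jordan_totient (card (handle_gens g)) m * (if m = 4 then 2 else 1)"
  proof (rule card_tuples_reflection[OF m0])
    fix c assume c: "c \<in> generating_tuples (dih m) (insert Gen_sigma (handle_gens g))" "?P c"
    then have "c \<in> braid_gens g \<rightarrow> carrier (dih m)" by (auto simp: generating_tuples_def braid_gens_eq)
    then have "handle_relations (dih m) g c" using c(2) H.satisfies_braid_rels_iff by blast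
    then show "fst (c Gen_sigma)" using sigma_reflection[OF m3 g] c(1) by (simp add: braid_gens_eq)
  next
    fix t k assume t: "t \<in> generating_tuples (integer_mod_group m) (handle_gens g)"
    have "refl_tuple m Gen_sigma (handle_gens g) k e t Gen_sigma \<noteq> \<one>\<^bsub>dih m\<^esub>" for e
      by (simp add: refl_tuple_def refl_coord_def)
    then show "card {e \<in> handle_gens g \<rightarrow>\<^sub>E UNIV. ?P (refl_tuple m Gen_sigma (handle_gens g) k e t)} =
        (if m = 4 then 2 else 1)"
      using card_braid_refl_patterns[OF m3 t, of k] by simp
  qed auto
  then show ?thesis
    using False by (simp add: num_admissible_epis_eq[OF m0] card_handle_gens braid_gens_eq)
qed

theorem corollary5p9:
  fixes g m :: nat
  assumes "g \<ge> 2" and "m \<ge> 2"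
  shows "real (num_admissible_epis_mod_aut g (dihedral_group m)) =
           real (num_admissible_epis g (dihedral_group m)) / real (order (AutoGroup (dihedral_group m)))
       \<and> real (num_admissible_epis_mod_aut g (dihedral_group m)) =
           (if m = 2 then 2 ^ (2 * g - 1) * real (jordan_totient (2 * g) 2)
            else if m = 4 then real (jordan_totient (2 * g) 4)
            else real (jordan_totient (2 * g) m) / real (totient m))"
proof -
  let ?D = "dihedral_group m"
  have m0: "m > 0" and \<phi>: "totient m > 0" using assms by simp_all
  note aut = order_AutoGroup_dihedral[OF assms(2)] and num = num_admissible_epis_dihedral[OF assms]
  have pos: "order (AutoGroup ?D) > 0" using m0 \<phi> by (simp add: aut)
  have "num_admissible_epis_mod_aut g ?D * order (AutoGroup ?D) = num_admissible_epis g ?D"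
    by (rule card_orbits_admissible[OF group_dihedral_group num_admissible_epis_eq(1)[OF m0]])
  then have "real (num_admissible_epis_mod_aut g ?D) * real (order (AutoGroup ?D)) = real (num_admissible_epis g ?D)"
    by (metis of_nat_mult)
  then have quot: "real (num_admissible_epis_mod_aut g ?D) = real (num_admissible_epis g ?D) / real (order (AutoGroup ?D))"
    using pos by (simp add: field_simps)
  moreover have "real (num_admissible_epis g ?D) / real (order (AutoGroup ?D)) =
      (if m = 2 then 2 ^ (2 * g - 1) * real (jordan_totient (2 * g) 2)
       else if m = 4 then real (jordan_totient (2 * g) 4)
       else real (jordan_totient (2 * g) m) / real (totient m))"
  proof -
    have "(2::real) ^ (2 * g) = 2 * 2 ^ (2 * g - 1)"
      using assms(1) by (simp flip: power_Suc)
    moreover have "totient 4 = 2"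
      using totient_prime_power[of 2 2] by simp
    ultimately show ?thesis using m0 \<phi> by (simp add: aut num)
  qed
  ultimately show ?thesis by simp
qed

end
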